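(* Assume: (1) $(PF)(x)\ge F(x)$ for all $x\in\mathbf X$; (2) there exist constants $L\in\mathbb R$, $C<\infty$ and $\rho\in(0,1)$ such that $\sup_{x\in\mathbf X}|(P^tF)(x)-L|\le C\rho^t$ for all $t\in\mathbb N_0$; (3) $\Delta G:=G(r)-G(n)>0$, and there exist $m\in\mathbb N_0$ and $\eta>0$ such that $\sum_{j=0}^m\big(L-\nu P^jF\big)\ge\Delta G+\eta$. Then there exist $\gamma_0\in(0,1)$ and a nonnegative integer $K<\infty$ such that $$\sup_{x\in\mathbf X}k^\star_\gamma(x)<K+1=:\bar K\qquad\text{for all }\gamma\in[\gamma_0,1).$$ Moreover, one may take $\gamma_0$ to be any constant in $(0,1)$ satisfying $$(1-\gamma_0)\Delta G\le\frac{\eta\,\gamma_0^{m+1}}{2(m+1)}\quad\text{and}\quad(1-\gamma_0^{m+1})\Delta G<\eta\,\gamma_0^{m+1}$$ (such a constant exists), and $$K=\min\{t\in\mathbb N_0: C\rho^t\le\delta_0/4\},\qquad \delta_0:=\frac{\eta\,\gamma_0^m}{m+1}.$$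
   Context: Setting. $\mathbf X$ is a Borel space, $P$ is a stochastic (Markov) kernel on $\mathbf X$ given $\mathbf X$, $\nu$ is a probability measure on $\mathbf X$, $F:\mathbf X\to[0,\infty]$ is measurable, and $G(n),G(r)\in[0,\infty)$ are constants. $\mathbb N_0=\{0,1,2,\dots\}$. $P^k$ is the $k$-fold composition of $P$ ($P^0$ is the identity kernel), $(P^kF)(x)=\int_{\mathbf X}F(y)P^k(dy\mid x)$, and $\nu P^kF=\int_{\mathbf X}(P^kF)(z)\,\nu(dz)$. The MDP $\{\mathbf S,\mathbf A,Q,c\}$ (the fully observed reduction of the Restart POMDP) has state space $\mathbf S=\mathbf X\times\mathbb N_0$ (last observed state, time elapsed since last restart), action space $\mathbf A=\{n,r\}$ ($n$: no intervention, $r$: restart), transition kernel $Q(dx'\times dk'\mid(x,k),n)=\delta_x(dx')\delta_{k+1}(dk')$, $Q(dx'\times dk'\mid(x,k),r)=\nu(dx')\delta_0(dk')$, and one-step cost $c(x,k;a)=(P^kF)(x)+G(a)$. A policy $\pi=\{\pi_t\}_{t\ge0}$ is a sequence of stochastic kernels $\pi_t$ on $\mathbf A$ given $(\mathbf S\times\mathbf A)^t\times\mathbf S$ (randomized, history-dependent). $\mathsf E^\pi_{x,k}$ is the expectation for the process $\{(S_t,A_t)\}$ of states and actions under $\pi$ started at $(x,k)$. For $\gamma\in(0,1)$, $V^\pi_\gamma(x,k)=\mathsf E^\pi_{x,k}\big[\sum_{t\ge0}\gamma^t c(S_t,A_t)\big]$ and $V_\gamma(x,k)=\inf_\pi V^\pi_\gamma(x,k)$.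 Threshold index: with $V_{0,\gamma}=\int_{\mathbf X}V_\gamma(z,0)\,\nu(dz)$ and $A(\gamma)=G(r)+\gamma V_{0,\gamma}$, $$k^\star_\gamma(x)=\inf\{k\in\mathbb N_0: A(\gamma)\le G(n)+\gamma V_\gamma(x,k+1)\}\in\mathbb N_0\cup\{\infty\},\qquad \inf\emptyset=\infty.$$ *)

theory Defs
  imports "HOL-Probability.Probability"
begin

text \<open>A Borel space is a Borel subset of a Polish space, with the trace of the Borel
  sigma-algebra. The Polish topology lives on a subset of the ambient type. A measurable space on
  this type that is isomorphic to such a subset is itself one, since every Borel subset of a Polish
  space carries a Polish topology with the same Borel sets. Of the measure argument only the space
  and the measurable sets matter.\<close>

definition polish_topology :: "'a topology \<Rightarrow> bool" where
  "polish_topology T \<longleftrightarrow> completely_metrizable_space T \<and> separable_space T"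

definition borel_measure_of :: "'a topology \<Rightarrow> 'a measure" where
  "borel_measure_of T = sigma (topspace T) {U. openin T U}"

definition borel_space :: "'a measure \<Rightarrow> bool" where
  "borel_space X \<longleftrightarrow>
     (\<exists>T. polish_topology T \<and> space X \<in> sets (borel_measure_of T) \<and>
          sets X = sets (restrict_space (borel_measure_of T) (space X)))"

definition stochastic_kernel :: "'b measure \<Rightarrow> 'a measure \<Rightarrow> ('b \<Rightarrow> 'a measure) \<Rightarrow> bool" where
  "stochastic_kernel Y X K \<longleftrightarrow> K \<in> Y \<rightarrow>\<^sub>M prob_algebra X"

primrec kernel_pow :: "'a measure \<Rightarrow> ('a \<Rightarrow> 'a measure) \<Rightarrow> nat \<Rightarrow> 'a \<Rightarrow> 'a measure" where
  "kernel_pow X P 0 = return X"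
| "kernel_pow X P (Suc k) = (\<lambda>x. kernel_pow X P k x \<bind> P)"

definition pow_fun ::
    "'a measure \<Rightarrow> ('a \<Rightarrow> 'a measure) \<Rightarrow> nat \<Rightarrow> ('a \<Rightarrow> ennreal) \<Rightarrow> 'a \<Rightarrow> ennreal" where
  "pow_fun X P k F x = (\<integral>\<^sup>+ y. F y \<partial>kernel_pow X P k x)"

definition init_pow_fun ::
    "'a measure \<Rightarrow> ('a \<Rightarrow> 'a measure) \<Rightarrow> 'a measure \<Rightarrow> nat \<Rightarrow> ('a \<Rightarrow> ennreal) \<Rightarrow> ennreal" where
  "init_pow_fun X P \<nu> k F = (\<integral>\<^sup>+ z. pow_fun X P k F z \<partial>\<nu>)"

text \<open>Discounted MDPs with state space \<open>S\<close>, action space \<open>A\<close>, transition kernel \<open>Q\<close> and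
  nonnegative cost \<open>c\<close>. A history in $(S \times A)^t$ is a function on the index set
  \<open>{0..<t}\<close>.\<close>

definition policies ::
    "'s measure \<Rightarrow> 'act measure \<Rightarrow> (nat \<Rightarrow> (nat \<Rightarrow> 's \<times> 'act) \<times> 's \<Rightarrow> 'act measure) set" where
  "policies S A =
     {\<pi>. \<forall>t. stochastic_kernel ((\<Pi>\<^sub>M i\<in>{0..<t}. S \<Otimes>\<^sub>M A) \<Otimes>\<^sub>M S) A (\<pi> t)}"

text \<open>The conditional law of $(S_t, A_t)$ given the history up to time $t - 1$.\<close>

definition process_kernel ::
    "'s measure \<Rightarrow> 'act measure \<Rightarrow> ('s \<times> 'act \<Rightarrow> 's measure) \<Rightarrow>
     (nat \<Rightarrow> (nat \<Rightarrow> 's \<times> 'act) \<times> 's \<Rightarrow> 'act measure) \<Rightarrow> 's \<Rightarrow>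
     nat \<Rightarrow> (nat \<Rightarrow> 's \<times> 'act) \<Rightarrow> ('s \<times> 'act) measure" where
  "process_kernel S A Q \<pi> s0 t h =
     (if t = 0 then return S s0 else Q (h (t - 1))) \<bind>
       (\<lambda>s. \<pi> t (h, s) \<bind> (\<lambda>a. return (S \<Otimes>\<^sub>M A) (s, a)))"

text \<open>The Ionescu-Tulcea law of the whole trajectory; this is the measure called \<open>PF.lim\<close>
  inside the locale \<open>Ionescu_Tulcea\<close>.\<close>

definition process_law ::
    "'s measure \<Rightarrow> 'act measure \<Rightarrow> ('s \<times> 'act \<Rightarrow> 's measure) \<Rightarrow>
     (nat \<Rightarrow> (nat \<Rightarrow> 's \<times> 'act) \<times> 's \<Rightarrow> 'act measure) \<Rightarrow> 's \<Rightarrow>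
     (nat \<Rightarrow> 's \<times> 'act) measure" where
  "process_law S A Q \<pi> s0 =
     projective_family.lim UNIV
       (Ionescu_Tulcea.CI (process_kernel S A Q \<pi> s0) (\<lambda>_. S \<Otimes>\<^sub>M A)) (\<lambda>_. S \<Otimes>\<^sub>M A)"

definition policy_value ::
    "'s measure \<Rightarrow> 'act measure \<Rightarrow> ('s \<times> 'act \<Rightarrow> 's measure) \<Rightarrow> ('s \<times> 'act \<Rightarrow> ennreal) \<Rightarrow>
     real \<Rightarrow> (nat \<Rightarrow> (nat \<Rightarrow> 's \<times> 'act) \<times> 's \<Rightarrow> 'act measure) \<Rightarrow> 's \<Rightarrow> ennreal" where
  "policy_value S A Q c \<gamma> \<pi> s0 =
     (\<integral>\<^sup>+ \<omega>. (\<Sum>t. ennreal (\<gamma> ^ t) * c (\<omega> t)) \<partial>process_law S A Q \<pi> s0)"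

definition optimal_value ::
    "'s measure \<Rightarrow> 'act measure \<Rightarrow> ('s \<times> 'act \<Rightarrow> 's measure) \<Rightarrow> ('s \<times> 'act \<Rightarrow> ennreal) \<Rightarrow>
     real \<Rightarrow> 's \<Rightarrow> ennreal" where
  "optimal_value S A Q c \<gamma> s0 = (INF \<pi>\<in>policies S A. policy_value S A Q c \<gamma> \<pi> s0)"

datatype action = NoInt | Restart

abbreviation action_space :: "action measure" where
  "action_space \<equiv> count_space UNIV"

definition state_space :: "'a measure \<Rightarrow> ('a \<times> nat) measure" where
  "state_space X = X \<Otimes>\<^sub>M count_space UNIV"

fun restart_kernel ::
    "'a measure \<Rightarrow> 'a measure \<Rightarrow> ('a \<times> nat) \<times> action \<Rightarrow> ('a \<times> nat) measure" where
  "restart_kernel X \<nu> ((x, k), NoInt) = return X x \<Otimes>\<^sub>M return (count_space UNIV) (k + 1)"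
| "restart_kernel X \<nu> ((x, k), Restart) = \<nu> \<Otimes>\<^sub>M return (count_space UNIV) 0"

fun restart_cost ::
    "'a measure \<Rightarrow> ('a \<Rightarrow> 'a measure) \<Rightarrow> ('a \<Rightarrow> ennreal) \<Rightarrow> (action \<Rightarrow> real) \<Rightarrow>
     ('a \<times> nat) \<times> action \<Rightarrow> ennreal" where
  "restart_cost X P F G ((x, k), a) = pow_fun X P k F x + ennreal (G a)"

definition restart_value ::
    "'a measure \<Rightarrow> ('a \<Rightarrow> 'a measure) \<Rightarrow> 'a measure \<Rightarrow> ('a \<Rightarrow> ennreal) \<Rightarrow> (action \<Rightarrow> real) \<Rightarrow>
     real \<Rightarrow> 'a \<Rightarrow> nat \<Rightarrow> ennreal" where
  "restart_value X P \<nu> F G \<gamma> x k =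
     optimal_value (state_space X) action_space (restart_kernel X \<nu>) (restart_cost X P F G) \<gamma> (x, k)"

definition restart_level ::
    "'a measure \<Rightarrow> ('a \<Rightarrow> 'a measure) \<Rightarrow> 'a measure \<Rightarrow> ('a \<Rightarrow> ennreal) \<Rightarrow> (action \<Rightarrow> real) \<Rightarrow>
     real \<Rightarrow> ennreal" where
  "restart_level X P \<nu> F G \<gamma> =
     ennreal (G Restart) + ennreal \<gamma> * (\<integral>\<^sup>+ z. restart_value X P \<nu> F G \<gamma> z 0 \<partial>\<nu>)"

definition threshold ::
    "'a measure \<Rightarrow> ('a \<Rightarrow> 'a measure) \<Rightarrow> 'a measure \<Rightarrow> ('a \<Rightarrow> ennreal) \<Rightarrow> (action \<Rightarrow> real) \<Rightarrow>
     real \<Rightarrow> 'a \<Rightarrow> enat" where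
  "threshold X P \<nu> F G \<gamma> x =
     Inf {enat k | k. restart_level X P \<nu> F G \<gamma>
            \<le> ennreal (G NoInt) + ennreal \<gamma> * restart_value X P \<nu> F G \<gamma> x (k + 1)}"

lemma Ionescu_Tulcea_process_kernel:
  assumes Q: "stochastic_kernel (S \<Otimes>\<^sub>M A) S Q" and \<pi>: "\<pi> \<in> policies S A" and s0: "s0 \<in> space S"
  shows "Ionescu_Tulcea (process_kernel S A Q \<pi> s0) (\<lambda>_. S \<Otimes>\<^sub>M A)"
proof -
  have [measurable]: "Q \<in> S \<Otimes>\<^sub>M A \<rightarrow>\<^sub>M prob_algebra S"
    using Q by (simp add: stochastic_kernel_def)
  have \<pi>m[measurable]: "\<pi> t \<in> (\<Pi>\<^sub>M i\<in>{0..<t}. S \<Otimes>\<^sub>M A) \<Otimes>\<^sub>M S \<rightarrow>\<^sub>M prob_algebra A" for t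
    using \<pi> by (auto simp: policies_def stochastic_kernel_def)
  have init: "(\<lambda>h. if t = 0 then return S s0 else Q (h (t - 1)))
        \<in> (\<Pi>\<^sub>M i\<in>{0..<t}. S \<Otimes>\<^sub>M A) \<rightarrow>\<^sub>M prob_algebra S" for t :: nat
  proof (cases "t = 0")
    case True
    have "return S s0 \<in> space (prob_algebra S)"
      using s0 by (simp add: space_prob_algebra prob_space_return)
    then show ?thesis using True by simp
  next
    case False
    then have "t - 1 \<in> {0..<t}" by auto
    then have "(\<lambda>h. h (t - 1)) \<in> (\<Pi>\<^sub>M i\<in>{0..<t}. S \<Otimes>\<^sub>M A) \<rightarrow>\<^sub>M S \<Otimes>\<^sub>M A"
      by (rule measurable_component_singleton)
    then have "(\<lambda>h. Q (h (t - 1))) \<in> (\<Pi>\<^sub>M i\<in>{0..<t}. S \<Otimes>\<^sub>M A) \<rightarrow>\<^sub>M prob_algebra S"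
      by measurable
    then show ?thesis using False by simp
  qed
  have m: "process_kernel S A Q \<pi> s0 t
      \<in> (\<Pi>\<^sub>M i\<in>{0..<t}. S \<Otimes>\<^sub>M A) \<rightarrow>\<^sub>M prob_algebra (S \<Otimes>\<^sub>M A)" for t
    unfolding process_kernel_def
    by (rule measurable_bind_prob_space2[OF init]) simp
  show ?thesis
  proof (rule Ionescu_Tulcea.intro)
    show "process_kernel S A Q \<pi> s0 i
      \<in> (\<Pi>\<^sub>M i\<in>{0..<i}. S \<Otimes>\<^sub>M A) \<rightarrow>\<^sub>M subprob_algebra (S \<Otimes>\<^sub>M A)" for i
      by (rule measurable_prob_algebraD[OF m])
    show "prob_space (process_kernel S A Q \<pi> s0 i h)"
      if "h \<in> space (\<Pi>\<^sub>M i\<in>{0..<i}. S \<Otimes>\<^sub>M A)" for i h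
      using measurable_space[OF m that] by (simp add: space_prob_algebra)
  qed
qed

lemma stochastic_kernel_restart:
  assumes \<nu>: "sets \<nu> = sets X" "prob_space \<nu>"
  shows "stochastic_kernel (state_space X \<Otimes>\<^sub>M action_space) (state_space X) (restart_kernel X \<nu>)"
proof -
  have \<nu>': "\<nu> \<in> space (prob_algebra X)" using \<nu> by (simp add: space_prob_algebra)
  have ret: "return (count_space UNIV) \<in> count_space UNIV \<rightarrow>\<^sub>M prob_algebra (count_space (UNIV::nat set))"
    by (rule measurable_return_prob_space)
  have retX: "return X \<in> X \<rightarrow>\<^sub>M prob_algebra X"
    by (rule measurable_return_prob_space)
  have eq: "restart_kernel X \<nu> = (\<lambda>(s, a). case a of
      NoInt \<Rightarrow> return X (fst s) \<Otimes>\<^sub>M return (count_space UNIV) (snd s + 1)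
    | Restart \<Rightarrow> \<nu> \<Otimes>\<^sub>M return (count_space UNIV) 0)"
    by (auto simp: fun_eq_iff split: action.split)
  have "(\<lambda>s. return X (fst s) \<Otimes>\<^sub>M return (count_space UNIV) (snd s + 1))
    \<in> X \<Otimes>\<^sub>M count_space UNIV \<rightarrow>\<^sub>M prob_algebra (X \<Otimes>\<^sub>M count_space (UNIV::nat set))"
    by (intro measurable_pair_prob measurable_compose[OF _ ret] measurable_compose[OF _ retX])
       measurable
  moreover have "(\<lambda>s. \<nu> \<Otimes>\<^sub>M return (count_space UNIV) 0)
    \<in> X \<Otimes>\<^sub>M count_space (UNIV::nat set) \<rightarrow>\<^sub>M prob_algebra (X \<Otimes>\<^sub>M count_space (UNIV::nat set))"
    by (intro measurable_pair_prob measurable_compose[OF _ ret] measurable_const \<nu>')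
       simp
  ultimately have b: "(\<lambda>s. restart_kernel X \<nu> (s, a))
    \<in> X \<Otimes>\<^sub>M count_space UNIV \<rightarrow>\<^sub>M prob_algebra (X \<Otimes>\<^sub>M count_space (UNIV::nat set))" for a
    unfolding eq by (cases a) simp_all
  have "countable (UNIV :: action set)"
  proof -
    have "(UNIV :: action set) = {NoInt, Restart}" using action.exhaust by blast
    then show ?thesis by (metis countable_finite finite.emptyI finite_insert)
  qed
  then have "(\<lambda>p. restart_kernel X \<nu> (fst p, snd p)) \<in>
     (X \<Otimes>\<^sub>M count_space UNIV) \<Otimes>\<^sub>M count_space UNIV \<rightarrow>\<^sub>M prob_algebra (X \<Otimes>\<^sub>M count_space (UNIV::nat set))"
    by (intro measurable_compose_countable'[where f = "\<lambda>a p. restart_kernel X \<nu> (fst p, a)"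
          and g = snd and I = UNIV])
       (auto intro: measurable_compose[OF measurable_fst b])
  then show ?thesis by (simp add: stochastic_kernel_def state_space_def)
qed

end

theory Submission
  imports Defs
begin

text \<open>Value iteration from \<open>0\<close> converges monotonically to a fixed point of the Bellman operator.
  Its iterates bound the cost of every policy from below, and the greedy stationary policy attains
  the fixed point, which is therefore the optimal value.

  Restarting every \<open>m + 1\<close> steps is an admissible strategy, and the gap assumption makes its mean
  cost per step smaller than $L + G(n)$ by at least $\delta_0$. After \<open>K\<close> steps without a restart the
  running cost is within $\delta_0 / 4$ of \<open>L\<close>, so waiting loses more per step than delaying the
  restart fee saves.\<close>

section \<open>Marginals of Ionescu-Tulcea measures\<close>

text \<open>Policies are randomized and depend on the whole history, but the expected discounted
  cost sees the trajectory law only through its marginals at single times, so only these are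
  extracted from the infinite product. Costs and values may a priori be infinite, hence the
  comparison arguments only add nonnegative terms; real numbers enter once never restarting has
  bounded all values.

  The constants form a budget. The gap is a gain per cycle of \<open>m + 1\<close> steps. The
  smallest discount weight in a cycle is \<gamma>^m, and \<open>m + 1\<close> bounds the discounted
  cycle length, so the gain per step is q = \<eta> \<gamma>^m / (m + 1). The smallest weight may be
  used since PF >= F makes P^j F increase to L, so every L - \<nu> P^j F is nonnegative. Restarting
  pays if \<gamma> (q - e) covers the interest (1 - \<gamma>) \<Delta>G on the postponed fee, where
  e bounds the distance of the running cost from L. The first condition on \<gamma>0 keeps the
  interest below \<gamma> q / 2, and the choice of K keeps e below q / 2.\<close>

context Ionescu_Tulcea
begin

text \<open>Here \<open>P n\<close> is the locale's kernel for coordinate \<open>n\<close>, and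
  \<open>C 0 (Suc n)\<close> extends \<open>C 0 n\<close> by it. Histories start from
  \<open>\<lambda>_. undefined\<close>, the single point of the empty product.\<close>

lemma nn_integral_C_last:
  assumes f[measurable]: "f \<in> borel_measurable (M n)"
  shows "(\<integral>\<^sup>+ h. f (h n) \<partial>C 0 (Suc n) (\<lambda>_. undefined))
       = (\<integral>\<^sup>+ h. \<integral>\<^sup>+ z. f z \<partial>P n h \<partial>C 0 n (\<lambda>_. undefined))"
proof -
  have u: "(\<lambda>_. undefined) \<in> space (PiM {0..<0} M)"
    by (simp add: space_PiM)
  have m: "(\<lambda>h. f (h n)) \<in> borel_measurable (PiM {0..<Suc n} M)"
    by measurable
  have "(\<integral>\<^sup>+ h. f (h n) \<partial>C 0 (Suc n) (\<lambda>_. undefined))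
      = (\<integral>\<^sup>+ h. \<integral>\<^sup>+ h'. f (h' n) \<partial>eP n h \<partial>C 0 n (\<lambda>_. undefined))"
    using measurable_eP[of n] sets_C[OF u, of n]
    by (simp add: nn_integral_bind[OF m] cong: measurable_cong_sets)
  also have "\<dots> = (\<integral>\<^sup>+ h. \<integral>\<^sup>+ z. f z \<partial>P n h \<partial>C 0 n (\<lambda>_. undefined))"
    by (rule nn_integral_cong) (simp add: space_C[OF u] nn_integral_eP[OF _ m])
  finally show ?thesis .
qed

text \<open>The limit measure is known through its projections to finite index sets, so coordinate
  \<open>n\<close> is read off from \<open>{0..<Suc n}\<close>, the shortest full history containing
  it.\<close>

lemma nn_integral_lim_component:
  assumes f[measurable]: "f \<in> borel_measurable (M n)"
  shows "(\<integral>\<^sup>+ \<omega>. f (\<omega> n) \<partial>PF.lim) = (\<integral>\<^sup>+ h. \<integral>\<^sup>+ z. f z \<partial>P n h \<partial>C 0 n (\<lambda>_. undefined))"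
proof -
  let ?J = "{0..<Suc n}"
  have u: "(\<lambda>_. undefined) \<in> space (PiM {0..<0} M)"
    by (simp add: space_PiM)
  have up: "up_to ?J = Suc n"
    unfolding up_to_def by (rule Least_equality) (auto simp: not_less_eq_eq[symmetric])
  have r: "(\<lambda>\<omega>. restrict \<omega> ?J) \<in> PF.lim \<rightarrow>\<^sub>M PiM ?J M"
    by (subst measurable_cong_sets[OF PF.sets_lim refl]) (rule measurable_restrict_subset, simp)
  have r': "(\<lambda>\<omega>. restrict \<omega> ?J) \<in> C 0 (Suc n) (\<lambda>_. undefined) \<rightarrow>\<^sub>M PiM ?J M"
    using sets_C[OF u, of "Suc n"]
    by (subst measurable_cong_sets[OF _ refl, of _ "PiM ?J M"]) (auto intro: measurable_restrict_subset)
  have m: "(\<lambda>h. f (h n)) \<in> borel_measurable (PiM ?J M)"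
    by measurable
  have "(\<integral>\<^sup>+ \<omega>. f (\<omega> n) \<partial>PF.lim) = (\<integral>\<^sup>+ h. f (h n) \<partial>distr PF.lim (PiM ?J M) (\<lambda>\<omega>. restrict \<omega> ?J))"
    by (subst nn_integral_distr[OF r]) (simp_all add: m)
  also have "\<dots> = (\<integral>\<^sup>+ h. f (h n) \<partial>C 0 (Suc n) (\<lambda>_. undefined))"
    unfolding distr_lim[OF finite_atLeastLessThan] CI_def up
    by (subst nn_integral_distr[OF r']) (simp_all add: m del: C.simps)
  finally show ?thesis
    by (simp only: nn_integral_C_last[OF f])
qed

end

section \<open>Comparison principles for discounted costs\<close>

locale controlled_process =
  fixes S :: "'s measure" and A :: "'act measure" and Q :: "'s \<times> 'act \<Rightarrow> 's measure"
    and \<pi> :: "nat \<Rightarrow> (nat \<Rightarrow> 's \<times> 'act) \<times> 's \<Rightarrow> 'act measure" and s0 :: 's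
  assumes Q: "stochastic_kernel (S \<Otimes>\<^sub>M A) S Q"
    and policy: "\<pi> \<in> policies S A"
    and s0: "s0 \<in> space S"
begin

sublocale Ionescu_Tulcea "process_kernel S A Q \<pi> s0" "\<lambda>_. S \<Otimes>\<^sub>M A"
  by (rule Ionescu_Tulcea_process_kernel[OF Q policy s0])

lemma Q_measurable[measurable]: "Q \<in> S \<Otimes>\<^sub>M A \<rightarrow>\<^sub>M prob_algebra S"
  using Q by (simp add: stochastic_kernel_def)

lemma policy_measurable[measurable]:
  "\<pi> t \<in> (\<Pi>\<^sub>M i\<in>{0..<t}. S \<Otimes>\<^sub>M A) \<Otimes>\<^sub>M S \<rightarrow>\<^sub>M prob_algebra A"
  using policy by (auto simp: policies_def stochastic_kernel_def)

lemma nn_integral_Q_measurable[measurable]: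
  assumes [measurable]: "u \<in> borel_measurable S"
  shows "(\<lambda>z. \<integral>\<^sup>+ s. u s \<partial>Q z) \<in> borel_measurable (S \<Otimes>\<^sub>M A)"
  by (rule measurable_compose[OF measurable_prob_algebraD[OF Q_measurable]
        nn_integral_measurable_subprob_algebra]) measurable

text \<open>Isolating the law of the state at time \<open>t\<close> splits a step of
  \<open>process_kernel\<close> into a draw by the dynamics and a draw by the policy.\<close>

definition next_state :: "nat \<Rightarrow> (nat \<Rightarrow> 's \<times> 'act) \<Rightarrow> 's measure" where
  "next_state t h = (if t = 0 then return S s0 else Q (h (t - 1)))"

lemma next_state_in_prob_algebra:
  assumes h: "h \<in> space (\<Pi>\<^sub>M i\<in>{0..<t}. S \<Otimes>\<^sub>M A)"
  shows "next_state t h \<in> space (prob_algebra S)"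
proof (cases "t = 0")
  case True
  then show ?thesis
    using s0 by (simp add: next_state_def space_prob_algebra prob_space_return)
next
  case False
  then have "h (t - 1) \<in> space (S \<Otimes>\<^sub>M A)"
    using h by (auto simp: space_PiM PiE_iff)
  then show ?thesis
    using False measurable_space[OF Q_measurable] by (simp add: next_state_def)
qed

lemma nn_integral_process_kernel:
  assumes h: "h \<in> space (\<Pi>\<^sub>M i\<in>{0..<t}. S \<Otimes>\<^sub>M A)"
    and f[measurable]: "f \<in> borel_measurable (S \<Otimes>\<^sub>M A)"
  shows "(\<integral>\<^sup>+ z. f z \<partial>process_kernel S A Q \<pi> s0 t h)
       = (\<integral>\<^sup>+ s. \<integral>\<^sup>+ a. f (s, a) \<partial>\<pi> t (h, s) \<partial>next_state t h)"
proof -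
  let ?N = "next_state t h"
  have N: "sets ?N = sets S"
    using next_state_in_prob_algebra[OF h] by (simp add: space_prob_algebra)
  have \<pi>h: "(\<lambda>s. \<pi> t (h, s)) \<in> S \<rightarrow>\<^sub>M prob_algebra A"
    using h by measurable
  have k: "(\<lambda>s. \<pi> t (h, s) \<bind> (\<lambda>a. return (S \<Otimes>\<^sub>M A) (s, a))) \<in> S \<rightarrow>\<^sub>M prob_algebra (S \<Otimes>\<^sub>M A)"
    by (rule measurable_bind_prob_space2[OF \<pi>h]) measurable
  have "(\<integral>\<^sup>+ z. f z \<partial>process_kernel S A Q \<pi> s0 t h)
      = (\<integral>\<^sup>+ s. \<integral>\<^sup>+ z. f z \<partial>(\<pi> t (h, s) \<bind> (\<lambda>a. return (S \<Otimes>\<^sub>M A) (s, a))) \<partial>?N)"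
    unfolding process_kernel_def next_state_def[symmetric]
    by (rule nn_integral_bind[OF f])
       (simp add: measurable_cong_sets[OF N refl] measurable_prob_algebraD[OF k])
  also have "\<dots> = (\<integral>\<^sup>+ s. \<integral>\<^sup>+ a. f (s, a) \<partial>\<pi> t (h, s) \<partial>?N)"
  proof (rule nn_integral_cong)
    fix s assume "s \<in> space ?N"
    then have s: "s \<in> space S"
      using sets_eq_imp_space_eq[OF N] by simp
    have A: "sets (\<pi> t (h, s)) = sets A"
      using measurable_space[OF \<pi>h s] by (simp add: space_prob_algebra)
    have "(\<lambda>a. return (S \<Otimes>\<^sub>M A) (s, a)) \<in> \<pi> t (h, s) \<rightarrow>\<^sub>M subprob_algebra (S \<Otimes>\<^sub>M A)"
      unfolding measurable_cong_sets[OF A refl] using s by measurable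
    then have "(\<integral>\<^sup>+ z. f z \<partial>(\<pi> t (h, s) \<bind> (\<lambda>a. return (S \<Otimes>\<^sub>M A) (s, a))))
        = (\<integral>\<^sup>+ a. \<integral>\<^sup>+ z. f z \<partial>return (S \<Otimes>\<^sub>M A) (s, a) \<partial>\<pi> t (h, s))"
      by (rule nn_integral_bind[OF f])
    also have "\<dots> = (\<integral>\<^sup>+ a. f (s, a) \<partial>\<pi> t (h, s))"
      using s sets_eq_imp_space_eq[OF A]
      by (intro nn_integral_cong nn_integral_return) (auto simp: space_pair_measure)
    finally show "(\<integral>\<^sup>+ z. f z \<partial>(\<pi> t (h, s) \<bind> (\<lambda>a. return (S \<Otimes>\<^sub>M A) (s, a))))
        = (\<integral>\<^sup>+ a. f (s, a) \<partial>\<pi> t (h, s))" .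
  qed
  finally show ?thesis .
qed

abbreviation law :: "(nat \<Rightarrow> 's \<times> 'act) measure" where
  "law \<equiv> process_law S A Q \<pi> s0"

definition expect_pair :: "nat \<Rightarrow> ('s \<times> 'act \<Rightarrow> ennreal) \<Rightarrow> ennreal" where
  "expect_pair t f = (\<integral>\<^sup>+ \<omega>. f (\<omega> t) \<partial>law)"

text \<open>Integrates over histories rather than over \<open>law\<close>. In this form it differs
  from the formula for \<open>expect_pair\<close> only by the innermost average over actions, so the
  two can be compared pointwise.\<close>

definition expect_state :: "nat \<Rightarrow> ('s \<Rightarrow> ennreal) \<Rightarrow> ennreal" where
  "expect_state t u = (\<integral>\<^sup>+ h. \<integral>\<^sup>+ s. u s \<partial>next_state t h \<partial>C 0 t (\<lambda>_. undefined))"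

lemma space_history: "space (C 0 t (\<lambda>_. undefined)) = space (\<Pi>\<^sub>M i\<in>{0..<t}. S \<Otimes>\<^sub>M A)"
  using space_C[of "\<lambda>_. undefined" 0 t] by (simp add: space_PiM)

lemma expect_pair_eq:
  assumes [measurable]: "f \<in> borel_measurable (S \<Otimes>\<^sub>M A)"
  shows "expect_pair t f =
    (\<integral>\<^sup>+ h. \<integral>\<^sup>+ s. \<integral>\<^sup>+ a. f (s, a) \<partial>\<pi> t (h, s) \<partial>next_state t h \<partial>C 0 t (\<lambda>_. undefined))"
  unfolding expect_pair_def process_law_def
  by (subst nn_integral_lim_component)
     (auto intro!: nn_integral_cong simp: space_history nn_integral_process_kernel)

lemma expect_state_0:
  assumes [measurable]: "u \<in> borel_measurable S"
  shows "expect_state 0 u = u s0"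
proof -
  interpret C: prob_space "C 0 0 (\<lambda>_. undefined)"
    by (rule prob_space_C) (simp add: space_PiM)
  show ?thesis
    using s0 C.emeasure_space_1
    by (simp add: expect_state_def next_state_def nn_integral_return del: C.simps)
qed

text \<open>\<open>next_state (Suc t) h\<close> is \<open>Q (h t)\<close>: it depends on the history
  only through its last pair, whose law is the marginal at time \<open>t\<close>.\<close>

lemma expect_state_Suc:
  assumes [measurable]: "u \<in> borel_measurable S"
  shows "expect_state (Suc t) u = expect_pair t (\<lambda>z. \<integral>\<^sup>+ s. u s \<partial>Q z)"
proof -
  show ?thesis
    unfolding expect_state_def expect_pair_def process_law_def
    by (subst nn_integral_lim_component)
       (simp_all add: next_state_def nn_integral_C_last[symmetric] del: C.simps)
qed

lemma sets_law: "sets law = sets (\<Pi>\<^sub>M i\<in>UNIV. S \<Otimes>\<^sub>M A)"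
  unfolding process_law_def by simp

lemma measurable_law_component[measurable (raw)]:
  assumes "f \<in> borel_measurable (S \<Otimes>\<^sub>M A)"
  shows "(\<lambda>\<omega>. f (\<omega> t)) \<in> borel_measurable law"
  unfolding measurable_cong_sets[OF sets_law refl]
  by (rule measurable_compose[OF _ assms], rule measurable_component_singleton) simp

lemma policy_value_eq_suminf:
  assumes c[measurable]: "c \<in> borel_measurable (S \<Otimes>\<^sub>M A)"
  shows "policy_value S A Q c \<gamma> \<pi> s0 = (\<Sum>t. ennreal (\<gamma> ^ t) * expect_pair t c)"
  unfolding policy_value_def expect_pair_def
  by (simp add: nn_integral_suminf nn_integral_cmult measurable_law_component[OF c])

lemma expect_pair_discounted:
  assumes [measurable]: "c \<in> borel_measurable (S \<Otimes>\<^sub>M A)" "u \<in> borel_measurable S"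
  shows "expect_pair t (\<lambda>z. c z + r * (\<integral>\<^sup>+ s. u s \<partial>Q z)) = expect_pair t c + r * expect_state (Suc t) u"
  using measurable_law_component[OF nn_integral_Q_measurable[OF assms(2)], of t]
    measurable_law_component[OF assms(1), of t]
  by (simp add: expect_state_Suc expect_pair_def nn_integral_add nn_integral_cmult)

lemma space_next_state:
  assumes "h \<in> space (C 0 t (\<lambda>_. undefined))"
  shows "space (next_state t h) = space S"
  using next_state_in_prob_algebra[of h t] assms sets_eq_imp_space_eq
  by (auto simp: space_history space_prob_algebra)

lemma policy_in_prob_algebra:
  assumes "h \<in> space (C 0 t (\<lambda>_. undefined))" "s \<in> space S"
  shows "\<pi> t (h, s) \<in> space (prob_algebra A)"
  using assms by (intro measurable_space[OF policy_measurable]) (auto simp: space_history space_pair_measure)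

text \<open>The action law has total mass one, so averaging the constant \<open>u s\<close> over
  actions returns it.\<close>

lemma expect_state_le_expect_pair:
  assumes f[measurable]: "f \<in> borel_measurable (S \<Otimes>\<^sub>M A)"
    and le: "\<And>s a. s \<in> space S \<Longrightarrow> a \<in> space A \<Longrightarrow> u s \<le> f (s, a)"
  shows "expect_state t u \<le> expect_pair t f"
  unfolding expect_pair_eq[OF f] expect_state_def
proof (intro nn_integral_mono)
  fix h s
  assume h: "h \<in> space (C 0 t (\<lambda>_. undefined))" and s: "s \<in> space (next_state t h)"
  have s': "s \<in> space S"
    using s space_next_state[OF h] by simp
  have "prob_space (\<pi> t (h, s))" and sA: "sets (\<pi> t (h, s)) = sets A"
    using policy_in_prob_algebra[OF h s'] by (auto simp: space_prob_algebra)
  then have "u s = (\<integral>\<^sup>+ a. u s \<partial>\<pi> t (h, s))"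
    by (simp add: prob_space.emeasure_space_1)
  also have "\<dots> \<le> (\<integral>\<^sup>+ a. f (s, a) \<partial>\<pi> t (h, s))"
    using le s' sets_eq_imp_space_eq[OF sA] by (intro nn_integral_mono) auto
  finally show "u s \<le> (\<integral>\<^sup>+ a. f (s, a) \<partial>\<pi> t (h, s))" .
qed

text \<open>\<open>w n\<close> plays the role of a lower bound for the cost with \<open>n\<close>
  steps to go. Its recursive inequality holds for each action and therefore survives averaging over
  any randomized choice.\<close>

lemma le_policy_value:
  assumes c[measurable]: "c \<in> borel_measurable (S \<Otimes>\<^sub>M A)" and \<gamma>: "0 \<le> \<gamma>"
    and w[measurable]: "\<And>n. w n \<in> borel_measurable S" and w0: "\<And>s. s \<in> space S \<Longrightarrow> w 0 s = 0"
    and wSuc: "\<And>n s a. s \<in> space S \<Longrightarrow> a \<in> space A \<Longrightarrow>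
      w (Suc n) s \<le> c (s, a) + ennreal \<gamma> * (\<integral>\<^sup>+ s'. w n s' \<partial>Q (s, a))"
  shows "w n s0 \<le> policy_value S A Q c \<gamma> \<pi> s0"
proof -
  have step: "expect_state t (w (Suc n)) \<le> expect_pair t c + ennreal \<gamma> * expect_state (Suc t) (w n)" for t n
    using expect_state_le_expect_pair[of "\<lambda>z. c z + ennreal \<gamma> * (\<integral>\<^sup>+ s'. w n s' \<partial>Q z)" "w (Suc n)" t] wSuc
    by (simp add: expect_pair_discounted)
  \<comment> \<open>After \<open>j\<close> steps, \<open>j\<close> costs are collected and the
    horizon left is \<open>n - j\<close>. At \<open>j = n\<close> the remainder involves
    \<open>w 0\<close> and vanishes.\<close>
  have partial: "expect_state 0 (w n) \<le>
      (\<Sum>t<j. ennreal (\<gamma> ^ t) * expect_pair t c) + ennreal (\<gamma> ^ j) * expect_state j (w (n - j))"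
    if "j \<le> n" for j
    using that
  proof (induction j)
    case (Suc j)
    have "expect_state j (w (n - j)) \<le> expect_pair j c + ennreal \<gamma> * expect_state (Suc j) (w (n - Suc j))"
      using step[of j "n - Suc j"] Suc.prems by (simp add: Suc_diff_Suc)
    from mult_left_mono[OF this, of "ennreal (\<gamma> ^ j)"]
    have "ennreal (\<gamma> ^ j) * expect_state j (w (n - j)) \<le> ennreal (\<gamma> ^ j) * expect_pair j c
       + ennreal (\<gamma> ^ Suc j) * expect_state (Suc j) (w (n - Suc j))"
      using \<gamma> by (simp add: ring_distribs ennreal_mult mult.assoc[symmetric] mult.commute)
    from order_trans[OF Suc.IH add_left_mono[OF this]] Suc.prems show ?case
      by (simp add: add.assoc)
  qed simp
  have "expect_state n (w 0) = 0"
  proof -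
    have "(\<integral>\<^sup>+ s. w 0 s \<partial>next_state n h) = 0" if "h \<in> space (C 0 n (\<lambda>_. undefined))" for h
      using nn_integral_cong[of "next_state n h" "w 0" "\<lambda>_. 0"] that
      by (simp add: space_next_state w0)
    then show ?thesis
      unfolding expect_state_def
      using nn_integral_cong[of "C 0 n (\<lambda>_. undefined)" "\<lambda>h. \<integral>\<^sup>+ s. w 0 s \<partial>next_state n h" "\<lambda>_. 0"]
      by simp
  qed
  then have "w n s0 \<le> (\<Sum>t<n. ennreal (\<gamma> ^ t) * expect_pair t c)"
    using partial[of n] by (simp add: expect_state_0)
  also have "\<dots> \<le> policy_value S A Q c \<gamma> \<pi> s0"
    unfolding policy_value_eq_suminf[OF c] by (rule sum_le_suminf) auto
  finally show ?thesis .
qed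

end

text \<open>The deterministic stationary policy given by \<open>f\<close> is the witness. Unrolling
  the inequality and dropping the nonnegative remainder keeps every partial sum below
  \<open>w s0\<close>, even where \<open>w\<close> is infinite.\<close>

lemma ex_policy_value_le:
  assumes Q: "stochastic_kernel (S \<Otimes>\<^sub>M A) S Q" and s0: "s0 \<in> space S"
    and c[measurable]: "c \<in> borel_measurable (S \<Otimes>\<^sub>M A)" and \<gamma>: "0 \<le> \<gamma>"
    and w[measurable]: "w \<in> borel_measurable S" and f[measurable]: "f \<in> S \<rightarrow>\<^sub>M A"
    and super: "\<And>s. s \<in> space S \<Longrightarrow>
      c (s, f s) + ennreal \<gamma> * (\<integral>\<^sup>+ s'. w s' \<partial>Q (s, f s)) \<le> w s"
  shows "\<exists>\<pi>\<in>policies S A. policy_value S A Q c \<gamma> \<pi> s0 \<le> w s0"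
proof
  let ?\<pi> = "\<lambda>(t::nat) (p::(nat \<Rightarrow> 'a \<times> 'b) \<times> 'a). return A (f (snd p))"
  show pol: "?\<pi> \<in> policies S A"
    unfolding policies_def stochastic_kernel_def
    by (auto intro!: measurable_compose[OF _ measurable_return_prob_space])
  interpret controlled_process S A Q ?\<pi> s0
    using Q pol s0 by unfold_locales
  have step: "expect_pair t c + ennreal \<gamma> * expect_state (Suc t) w \<le> expect_state t w" for t
  proof -
    have "expect_pair t (\<lambda>z. c z + ennreal \<gamma> * (\<integral>\<^sup>+ s'. w s' \<partial>Q z)) \<le> expect_state t w"
      unfolding expect_state_def
    proof (subst expect_pair_eq, measurable, intro nn_integral_mono)
      fix h s
      assume h: "h \<in> space (C 0 t (\<lambda>_. undefined))" and s: "s \<in> space (next_state t h)"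
      have s': "s \<in> space S"
        using s space_next_state[OF h] by simp
      have "(\<lambda>a. c (s, a) + ennreal \<gamma> * (\<integral>\<^sup>+ s'. w s' \<partial>Q (s, a))) \<in> borel_measurable A"
        using measurable_compose[OF measurable_Pair1'[OF s', of A], of
          "\<lambda>z. c z + ennreal \<gamma> * (\<integral>\<^sup>+ s'. w s' \<partial>Q z)" borel] by measurable
      then show "(\<integral>\<^sup>+ a. c (s, a) + ennreal \<gamma> * (\<integral>\<^sup>+ s'. w s' \<partial>Q (s, a)) \<partial>return A (f (snd (h, s)))) \<le> w s"
        using super[OF s'] measurable_space[OF f s'] by (simp add: nn_integral_return)
    qed
    then show ?thesis
      by (simp add: expect_pair_discounted)
  qed
  have partial: "(\<Sum>t<j. ennreal (\<gamma> ^ t) * expect_pair t c) + ennreal (\<gamma> ^ j) * expect_state j w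
      \<le> expect_state 0 w" for j
  proof (induction j)
    case (Suc j)
    from mult_left_mono[OF step[of j], of "ennreal (\<gamma> ^ j)"]
    have "ennreal (\<gamma> ^ j) * expect_pair j c + ennreal (\<gamma> ^ Suc j) * expect_state (Suc j) w
      \<le> ennreal (\<gamma> ^ j) * expect_state j w"
      using \<gamma> by (simp add: ring_distribs ennreal_mult mult.assoc[symmetric] mult.commute)
    from order_trans[OF add_left_mono[OF this] Suc.IH] show ?case
      by (simp add: add.assoc)
  qed simp
  show "policy_value S A Q c \<gamma> ?\<pi> s0 \<le> w s0"
    unfolding policy_value_eq_suminf[OF c]
  proof (rule suminf_le_const)
    fix n
    have "(\<Sum>t<n. ennreal (\<gamma> ^ t) * expect_pair t c) \<le> expect_state 0 w"
      using order_trans[OF _ partial[of n]] by simp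
    then show "(\<Sum>t<n. ennreal (\<gamma> ^ t) * expect_pair t c) \<le> w s0"
      by (simp add: expect_state_0)
  qed simp
qed

text \<open>Both sides are limits of the same sequence. This lets the minimum over the two actions
  commute with the limit of value iteration.\<close>

lemma SUP_min_incseq:
  fixes f g :: "nat \<Rightarrow> 'b::{complete_linorder, linorder_topology}"
  assumes "incseq f" "incseq g"
  shows "(SUP n. min (f n) (g n)) = min (SUP n. f n) (SUP n. g n)"
proof (rule LIMSEQ_unique)
  show "(\<lambda>n. min (f n) (g n)) \<longlonglongrightarrow> (SUP n. min (f n) (g n))"
    using assms by (intro LIMSEQ_SUP) (simp add: incseq_def min.coboundedI1 min.coboundedI2)
  show "(\<lambda>n. min (f n) (g n)) \<longlonglongrightarrow> min (SUP n. f n) (SUP n. g n)"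
    using assms by (intro tendsto_min LIMSEQ_SUP)
qed

section \<open>The functions P^k F: measurability and monotonicity in k\<close>

lemma kernel_pow_measurable:
  assumes "stochastic_kernel X X P"
  shows "kernel_pow X P k \<in> X \<rightarrow>\<^sub>M prob_algebra X"
proof (induction k)
  case (Suc k)
  then show ?case
    using assms by (simp add: stochastic_kernel_def measurable_bind_prob_space)
qed (simp add: measurable_return_prob_space)

lemma pow_fun_measurable:
  assumes "stochastic_kernel X X P" and F: "F \<in> borel_measurable X"
  shows "pow_fun X P k F \<in> borel_measurable X"
  unfolding pow_fun_def
  by (rule measurable_compose[OF measurable_prob_algebraD[OF kernel_pow_measurable[OF assms(1)]]
        nn_integral_measurable_subprob_algebra[OF F]])

text \<open>\<open>kernel_pow\<close> appends the new transition at the end, so the next iterate is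
  P^k applied to PF. In this order F <= PF can be used under the integral.\<close>

lemma pow_fun_Suc:
  assumes P: "stochastic_kernel X X P" and F: "F \<in> borel_measurable X" and x: "x \<in> space X"
  shows "pow_fun X P (Suc k) F x = (\<integral>\<^sup>+ y. (\<integral>\<^sup>+ z. F z \<partial>P y) \<partial>kernel_pow X P k x)"
proof -
  have s: "sets (kernel_pow X P k x) = sets X"
    using measurable_space[OF kernel_pow_measurable[OF P] x] by (simp add: space_prob_algebra)
  show ?thesis
    using P unfolding pow_fun_def kernel_pow.simps stochastic_kernel_def
    by (intro nn_integral_bind[OF F])
       (simp add: measurable_cong_sets[OF s refl] measurable_prob_algebraD)
qed

lemma pow_fun_1:
  assumes P: "stochastic_kernel X X P" and F: "F \<in> borel_measurable X" and x: "x \<in> space X"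
  shows "pow_fun X P 1 F x = (\<integral>\<^sup>+ z. F z \<partial>P x)"
proof -
  have "(\<lambda>y. \<integral>\<^sup>+ z. F z \<partial>P y) \<in> borel_measurable X"
    using P unfolding stochastic_kernel_def
    by (rule measurable_compose[OF measurable_prob_algebraD
          nn_integral_measurable_subprob_algebra[OF F]])
  then show ?thesis
    using pow_fun_Suc[OF P F x, of 0] x by (simp add: nn_integral_return)
qed

lemma incseq_pow_fun:
  assumes P: "stochastic_kernel X X P" and F: "F \<in> borel_measurable X" and x: "x \<in> space X"
    and mono: "\<And>y. y \<in> space X \<Longrightarrow> F y \<le> pow_fun X P 1 F y"
  shows "incseq (\<lambda>k. pow_fun X P k F x)"
proof (rule incseq_SucI)
  fix k
  have s: "space (kernel_pow X P k x) = space X"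
    using measurable_space[OF kernel_pow_measurable[OF P] x]
    by (intro sets_eq_imp_space_eq) (simp add: space_prob_algebra)
  show "pow_fun X P k F x \<le> pow_fun X P (Suc k) F x"
    unfolding pow_fun_Suc[OF P F x]
    using mono unfolding pow_fun_def[of X P k]
    by (intro nn_integral_mono) (simp add: s pow_fun_1[OF P F] del: One_nat_def)
qed

section \<open>The Bellman equation of the restart problem\<close>

locale restart_problem =
  fixes X :: "'a measure" and P :: "'a \<Rightarrow> 'a measure" and \<nu> :: "'a measure"
    and F :: "'a \<Rightarrow> ennreal" and G :: "action \<Rightarrow> real" and \<gamma> :: real
  assumes P: "stochastic_kernel X X P"
    and \<nu>: "prob_space \<nu>" "sets \<nu> = sets X"
    and F[measurable]: "F \<in> borel_measurable X"
    and \<gamma>: "0 < \<gamma>"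
begin

abbreviation state_cost :: "nat \<Rightarrow> 'a \<Rightarrow> ennreal" where
  "state_cost k x \<equiv> pow_fun X P k F x"

definition bellman :: "('a \<times> nat \<Rightarrow> ennreal) \<Rightarrow> 'a \<times> nat \<Rightarrow> ennreal" where
  "bellman u = (\<lambda>(x, k).
     min (state_cost k x + ennreal (G NoInt) + ennreal \<gamma> * u (x, Suc k))
         (state_cost k x + ennreal (G Restart) + ennreal \<gamma> * (\<integral>\<^sup>+ z. u (z, 0) \<partial>\<nu>)))"

definition value_iter :: "nat \<Rightarrow> 'a \<times> nat \<Rightarrow> ennreal" where
  "value_iter n = (bellman ^^ n) (\<lambda>_. 0)"

definition bellman_value :: "'a \<times> nat \<Rightarrow> ennreal" where
  "bellman_value s = (SUP n. value_iter n s)"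

text \<open>The age coordinate is countable and discrete, so measurability can be checked on each
  slice of fixed age.\<close>

lemma measurable_state_spaceI:
  fixes u :: "'a \<times> nat \<Rightarrow> ennreal"
  assumes "\<And>k. (\<lambda>x. u (x, k)) \<in> borel_measurable X"
  shows "u \<in> borel_measurable (state_space X)"
proof -
  have "(\<lambda>s. (\<lambda>k s. u (fst s, k)) (snd s) s) \<in> borel_measurable (X \<Otimes>\<^sub>M count_space UNIV)"
    by (rule measurable_compose_countable'[where I=UNIV])
       (auto intro: measurable_compose[OF measurable_fst assms])
  then show ?thesis
    by (simp add: state_space_def)
qed

lemma measurable_state_spaceD:
  assumes "u \<in> borel_measurable (state_space X)"
  shows "(\<lambda>x. u (x, k)) \<in> borel_measurable X"
  using assms unfolding state_space_def by (rule measurable_compose[rotated]) measurable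

lemma state_cost_measurable[measurable]: "pow_fun X P k F \<in> borel_measurable X"
  by (rule pow_fun_measurable[OF P F])

lemma bellman_measurable:
  assumes u: "u \<in> borel_measurable (state_space X)"
  shows "bellman u \<in> borel_measurable (state_space X)"
proof (rule measurable_state_spaceI)
  note measurable_state_spaceD[OF u, measurable]
  show "(\<lambda>x. bellman u (x, k)) \<in> borel_measurable X" for k
    unfolding bellman_def by simp
qed

lemma bellman_mono:
  assumes "\<And>s. u s \<le> v s" shows "bellman u s \<le> bellman v s"
  using assms unfolding bellman_def
  by (cases s) (simp only: prod.case, intro min.mono add_left_mono mult_left_mono nn_integral_mono; simp)

lemma value_iter_0: "value_iter 0 s = 0"
  by (simp add: value_iter_def)

lemma value_iter_Suc: "value_iter (Suc n) = bellman (value_iter n)"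
  by (simp add: value_iter_def)

lemma value_iter_measurable: "value_iter n \<in> borel_measurable (state_space X)"
  by (induction n) (simp_all add: value_iter_Suc bellman_measurable, simp add: value_iter_def)

lemma incseq_value_iter: "incseq (\<lambda>n. value_iter n s)"
proof (rule incseq_SucI)
  show "value_iter n s \<le> value_iter (Suc n) s" for n
  proof (induction n arbitrary: s)
    case (Suc n)
    then show ?case
      unfolding value_iter_Suc[of n] value_iter_Suc[of "Suc n"] by (rule bellman_mono)
  qed (simp add: value_iter_0)
qed

lemma bellman_value_measurable: "bellman_value \<in> borel_measurable (state_space X)"
  unfolding bellman_value_def[abs_def] by (intro borel_measurable_SUP value_iter_measurable) simp

text \<open>Adding a constant, scaling, integrating and taking the minimum of two all commute with
  suprema of increasing sequences. The image of the limit is thus the limit of the shifted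
  iterates.\<close>

lemma bellman_value_fixpoint: "bellman bellman_value = bellman_value"
proof
  fix s :: "'a \<times> nat"
  obtain x k where s: "s = (x, k)" by (cases s)
  let ?a = "\<lambda>n. state_cost k x + ennreal (G NoInt) + ennreal \<gamma> * value_iter n (x, Suc k)"
  let ?b = "\<lambda>n. state_cost k x + ennreal (G Restart) + ennreal \<gamma> * (\<integral>\<^sup>+ z. value_iter n (z, 0) \<partial>\<nu>)"
  have meas: "(\<lambda>z. value_iter n (z, 0)) \<in> borel_measurable \<nu>" for n
    using measurable_state_spaceD[OF value_iter_measurable] by (simp add: measurable_cong_sets[OF \<nu>(2) refl])
  have inc: "incseq (\<lambda>n z. value_iter n (z, 0))"
    using incseq_value_iter by (auto simp: incseq_def le_fun_def)
  have int: "(\<integral>\<^sup>+ z. bellman_value (z, 0) \<partial>\<nu>) = (SUP n. \<integral>\<^sup>+ z. value_iter n (z, 0) \<partial>\<nu>)"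
    unfolding bellman_value_def by (rule nn_integral_monotone_convergence_SUP[OF inc meas])
  have incI: "incseq (\<lambda>n. \<integral>\<^sup>+ z. value_iter n (z, 0) \<partial>\<nu>)"
    using incseq_value_iter by (auto simp: incseq_def intro: nn_integral_mono)
  have ia: "incseq ?a"
    using incseq_value_iter by (auto simp: incseq_def intro!: add_left_mono mult_left_mono)
  have ib: "incseq ?b"
    using incI by (auto simp: incseq_def intro!: add_left_mono mult_left_mono)
  have "bellman bellman_value s = min (SUP n. ?a n) (SUP n. ?b n)"
    unfolding s bellman_def int
    by (simp add: bellman_value_def SUP_mult_left_ennreal ennreal_SUP_add_right)
  also have "\<dots> = (SUP n. value_iter (Suc n) s)"
    unfolding SUP_min_incseq[OF ia ib, symmetric] s value_iter_Suc by (simp add: bellman_def)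
  also have "\<dots> = bellman_value s"
    unfolding bellman_value_def
  proof (rule antisym)
    show "(SUP n. value_iter (Suc n) s) \<le> (SUP n. value_iter n s)"
      by (rule SUP_mono) auto
    show "(SUP n. value_iter n s) \<le> (SUP n. value_iter (Suc n) s)"
      using incseq_SucD[OF incseq_value_iter] by (intro SUP_mono) blast
  qed
  finally show "bellman bellman_value s = bellman_value s" .
qed

section \<open>Integrals against the restart transition, and the fixed point as optimal
  value\<close>

lemma nn_integral_restart_kernel_NoInt:
  assumes u: "u \<in> borel_measurable (state_space X)" and x: "x \<in> space X"
  shows "(\<integral>\<^sup>+ s. u s \<partial>restart_kernel X \<nu> ((x, k), NoInt)) = u (x, Suc k)"
proof -
  interpret N: prob_space "return (count_space UNIV) (Suc k)"
    by (rule prob_space_return) simp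
  have m: "u \<in> borel_measurable (return X x \<Otimes>\<^sub>M return (count_space UNIV) (Suc k))"
    using u unfolding state_space_def
    by (subst measurable_cong_sets[OF sets_pair_measure_cong refl]) auto
  have "(\<integral>\<^sup>+ s. u s \<partial>restart_kernel X \<nu> ((x, k), NoInt))
      = (\<integral>\<^sup>+ y. \<integral>\<^sup>+ j. u (y, j) \<partial>return (count_space UNIV) (Suc k) \<partial>return X x)"
    using N.nn_integral_fst[OF m] by simp
  also have "\<dots> = u (x, Suc k)"
    using x measurable_state_spaceD[OF u] by (simp add: nn_integral_return)
  finally show ?thesis .
qed

lemma nn_integral_restart_kernel_Restart:
  assumes u: "u \<in> borel_measurable (state_space X)"
  shows "(\<integral>\<^sup>+ s. u s \<partial>restart_kernel X \<nu> ((x, k), Restart)) = (\<integral>\<^sup>+ z. u (z, 0) \<partial>\<nu>)"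
proof -
  interpret N: prob_space "return (count_space UNIV) (0::nat)"
    by (rule prob_space_return) simp
  have m: "u \<in> borel_measurable (\<nu> \<Otimes>\<^sub>M return (count_space UNIV) 0)"
    using u \<nu>(2) unfolding state_space_def
    by (subst measurable_cong_sets[OF sets_pair_measure_cong refl]) auto
  have "(\<integral>\<^sup>+ s. u s \<partial>restart_kernel X \<nu> ((x, k), Restart))
      = (\<integral>\<^sup>+ y. \<integral>\<^sup>+ j. u (y, j) \<partial>return (count_space UNIV) 0 \<partial>\<nu>)"
    using N.nn_integral_fst[OF m] by simp
  then show ?thesis
    by (simp add: nn_integral_return)
qed

lemma restart_cost_measurable:
  "restart_cost X P F G \<in> borel_measurable (state_space X \<Otimes>\<^sub>M action_space)"
proof -
  have "(UNIV :: action set) = {NoInt, Restart}"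
    using action.exhaust by blast
  then have c: "countable (UNIV :: action set)"
    by (metis countable_finite finite.emptyI finite_insert)
  have r: "(\<lambda>s. restart_cost X P F G (s, a)) \<in> borel_measurable (state_space X)" for a
    by (rule measurable_state_spaceI) simp
  have "(\<lambda>z. (\<lambda>a z. restart_cost X P F G (fst z, a)) (snd z) z)
      \<in> borel_measurable (state_space X \<Otimes>\<^sub>M action_space)"
    by (rule measurable_compose_countable'[where I=UNIV])
       (auto intro: measurable_compose[OF measurable_fst r] c)
  then show ?thesis
    by simp
qed

lemma restart_value_eq_bellman_value:
  assumes x: "x \<in> space X"
  shows "restart_value X P \<nu> F G \<gamma> x k = bellman_value (x, k)"
proof (rule antisym)
  have Q: "stochastic_kernel (state_space X \<Otimes>\<^sub>M action_space) (state_space X) (restart_kernel X \<nu>)"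
    by (rule stochastic_kernel_restart[OF \<nu>(2,1)])
  have s0: "(x, k) \<in> space (state_space X)"
    using x by (simp add: state_space_def space_pair_measure)
  show "bellman_value (x, k) \<le> restart_value X P \<nu> F G \<gamma> x k"
    unfolding restart_value_def optimal_value_def bellman_value_def
  proof (intro SUP_least INF_greatest)
    fix n \<pi> assume \<pi>: "\<pi> \<in> policies (state_space X) action_space"
    interpret controlled_process "state_space X" action_space "restart_kernel X \<nu>" \<pi> "(x, k)"
      using Q \<pi> s0 by unfold_locales
    show "value_iter n (x, k) \<le> policy_value (state_space X) action_space (restart_kernel X \<nu>)
        (restart_cost X P F G) \<gamma> \<pi> (x, k)"
    proof (rule le_policy_value[OF restart_cost_measurable])
      fix n :: nat and s :: "'a \<times> nat" and a :: action
      assume s: "s \<in> space (state_space X)"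
      obtain y j where sy: "s = (y, j)" by (cases s)
      have y: "y \<in> space X"
        using s by (simp add: sy state_space_def space_pair_measure)
      show "value_iter (Suc n) s \<le> restart_cost X P F G (s, a)
          + ennreal \<gamma> * (\<integral>\<^sup>+ s'. value_iter n s' \<partial>restart_kernel X \<nu> (s, a))"
        using nn_integral_restart_kernel_NoInt[OF value_iter_measurable[of n] y, of j]
          nn_integral_restart_kernel_Restart[OF value_iter_measurable[of n], of y j]
        unfolding sy value_iter_Suc bellman_def
        by (cases a) (simp_all del: restart_kernel.simps)
    qed (use \<gamma> in \<open>auto simp: value_iter_measurable value_iter_0\<close>)
  qed
  define cn where "cn = (\<lambda>(x, k). state_cost k x + ennreal (G NoInt) + ennreal \<gamma> * bellman_value (x, Suc k))"
  define cr where "cr = (\<lambda>(x, k). state_cost k x + ennreal (G Restart)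
      + ennreal \<gamma> * (\<integral>\<^sup>+ z. bellman_value (z, 0) \<partial>\<nu>))"
  \<comment> \<open>The greedy choice; it is measurable because it compares the measurable functions
    \<open>cn\<close> and \<open>cr\<close>. Ties go to \<open>NoInt\<close>.\<close>
  define f where "f s = (if cn s \<le> cr s then NoInt else Restart)" for s
  note measurable_state_spaceD[OF bellman_value_measurable, measurable]
  have [measurable]: "cn \<in> borel_measurable (state_space X)" "cr \<in> borel_measurable (state_space X)"
    unfolding cn_def cr_def by (auto intro!: measurable_state_spaceI)
  have "\<exists>\<pi>\<in>policies (state_space X) action_space. policy_value (state_space X) action_space
      (restart_kernel X \<nu>) (restart_cost X P F G) \<gamma> \<pi> (x, k) \<le> bellman_value (x, k)"
  proof (rule ex_policy_value_le[OF Q s0 restart_cost_measurable _ bellman_value_measurable])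
    show "f \<in> state_space X \<rightarrow>\<^sub>M action_space"
      unfolding f_def[abs_def] by measurable
    fix s assume s: "s \<in> space (state_space X)"
    obtain y j where sy: "s = (y, j)" by (cases s)
    have y: "y \<in> space X"
      using s by (simp add: sy state_space_def space_pair_measure)
    have "bellman_value (y, j) = min (cn (y, j)) (cr (y, j))"
      by (subst bellman_value_fixpoint[symmetric]) (simp add: bellman_def cn_def cr_def)
    then show "restart_cost X P F G (s, f s)
        + ennreal \<gamma> * (\<integral>\<^sup>+ s'. bellman_value s' \<partial>restart_kernel X \<nu> (s, f s)) \<le> bellman_value s"
      using nn_integral_restart_kernel_NoInt[OF bellman_value_measurable y, of j]
        nn_integral_restart_kernel_Restart[OF bellman_value_measurable, of y j]
      by (auto simp: sy f_def cn_def cr_def min_def simp del: restart_kernel.simps)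
  qed (use \<gamma> in simp)
  then show "restart_value X P \<nu> F G \<gamma> x k \<le> bellman_value (x, k)"
    unfolding restart_value_def optimal_value_def by (auto intro: INF_lower2)
qed

lemma restart_value_measurable: "(\<lambda>x. restart_value X P \<nu> F G \<gamma> x k) \<in> borel_measurable X"
  using measurable_state_spaceD[OF bellman_value_measurable, of k]
  by (simp add: restart_value_eq_bellman_value cong: measurable_cong)

lemma restart_value_bellman:
  assumes x: "x \<in> space X"
  shows "restart_value X P \<nu> F G \<gamma> x k =
    min (state_cost k x + ennreal (G NoInt) + ennreal \<gamma> * restart_value X P \<nu> F G \<gamma> x (Suc k))
        (state_cost k x + restart_level X P \<nu> F G \<gamma>)"
proof -
  have "(\<integral>\<^sup>+ z. restart_value X P \<nu> F G \<gamma> z 0 \<partial>\<nu>) = (\<integral>\<^sup>+ z. bellman_value (z, 0) \<partial>\<nu>)"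
    using sets_eq_imp_space_eq[OF \<nu>(2)]
    by (intro nn_integral_cong) (simp add: restart_value_eq_bellman_value)
  then show ?thesis
    unfolding restart_level_def restart_value_eq_bellman_value[OF x]
    by (subst bellman_value_fixpoint[symmetric]) (simp add: bellman_def add.assoc)
qed

text \<open>The no-intervention branch alone carries \<open>B\<close> through value iteration, so
  any such \<open>B\<close> dominates the cost of never restarting.\<close>

lemma restart_value_le:
  assumes B: "\<And>y k. y \<in> space X \<Longrightarrow> state_cost k y + ennreal (G NoInt) + ennreal \<gamma> * B \<le> B"
    and x: "x \<in> space X"
  shows "restart_value X P \<nu> F G \<gamma> x k \<le> B"
proof -
  have "value_iter n (x, k) \<le> B" for n
  proof (induction n arbitrary: k)
    case (Suc n)
    have "value_iter (Suc n) (x, k)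
        \<le> state_cost k x + ennreal (G NoInt) + ennreal \<gamma> * value_iter n (x, Suc k)"
      by (simp add: value_iter_Suc bellman_def)
    also have "\<dots> \<le> state_cost k x + ennreal (G NoInt) + ennreal \<gamma> * B"
      by (intro add_left_mono mult_left_mono Suc) simp
    finally show ?case
      using B[OF x] by (rule order_trans)
  qed (simp add: value_iter_0)
  then show ?thesis
    unfolding restart_value_eq_bellman_value[OF x] bellman_value_def by (rule SUP_least)
qed

end

section \<open>Bounding the threshold\<close>

text \<open>In the application \<open>a j\<close> is the value at age \<open>j\<close> averaged over
  \<nu>, \<open>p j\<close> is \<nu> P^j F, \<open>c\<close> is G(n) and \<open>D\<close> is the fee
  difference. The cycle waits at ages below \<open>m\<close> and restarts at age \<open>m\<close>,
  returning to \<open>a 0\<close> after \<open>m + 1\<close> steps.\<close>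

lemma cycle_average_le:
  fixes a p :: "nat \<Rightarrow> real"
  assumes \<gamma>: "0 < \<gamma>" "\<gamma> < 1"
    and step: "\<And>j. a j \<le> p j + c + \<gamma> * a (Suc j)"
    and last: "a m \<le> p m + c + D + \<gamma> * a 0"
    and p: "\<And>j. p j \<le> L"
    and gap: "D + \<eta> \<le> (\<Sum>j\<le>m. L - p j)" "0 \<le> \<eta>"
  shows "(1 - \<gamma>) * a 0 \<le> L + c - \<gamma> ^ m * \<eta> / (real m + 1)"
proof -
  define s where "s = (\<Sum>j\<le>m. \<gamma> ^ j)"
  have unroll: "a 0 \<le> (\<Sum>j<n. \<gamma> ^ j * (p j + c)) + \<gamma> ^ n * a n" for n
  proof (induction n)
    case (Suc n)
    have "\<gamma> ^ n * a n \<le> \<gamma> ^ n * (p n + c + \<gamma> * a (Suc n))"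
      using \<gamma> step by (intro mult_left_mono) auto
    with Suc show ?case by (simp add: algebra_simps)
  qed simp
  have "\<gamma> ^ m * a m \<le> \<gamma> ^ m * (p m + c + D + \<gamma> * a 0)"
    using \<gamma> last by (intro mult_left_mono) auto
  \<comment> \<open>The extra fee is paid at age \<open>m\<close>, hence its weight \<gamma>^m; the
    next cycle begins one step later.\<close>
  with unroll[of m] have cycle: "a 0 \<le> (\<Sum>j\<le>m. \<gamma> ^ j * (p j + c)) + \<gamma> ^ m * D + \<gamma> ^ Suc m * a 0"
    by (simp add: algebra_simps lessThan_Suc_atMost[symmetric])
  have "\<gamma> ^ m * (D + \<eta>) \<le> \<gamma> ^ m * (\<Sum>j\<le>m. L - p j)"
    using \<gamma> gap by (intro mult_left_mono) auto
  also have "\<dots> = (\<Sum>j\<le>m. \<gamma> ^ m * (L - p j))"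
    by (rule sum_distrib_left)
  \<comment> \<open>Every \<open>L - p j\<close> is nonnegative, so its weight \<gamma>^m may be
    raised to \<gamma>^j.\<close>
  also have "\<dots> \<le> (\<Sum>j\<le>m. \<gamma> ^ j * (L - p j))"
    using \<gamma> p by (intro sum_mono mult_right_mono power_decreasing) auto
  also have "\<dots> = (L + c) * s - (\<Sum>j\<le>m. \<gamma> ^ j * (p j + c))"
    by (simp add: s_def sum_distrib_left sum_subtractf[symmetric] algebra_simps)
  finally have "a 0 * (1 - \<gamma> ^ Suc m) \<le> (L + c) * s - \<gamma> ^ m * \<eta>"
    using cycle by (simp add: algebra_simps)
  moreover have "1 - \<gamma> ^ Suc m = (1 - \<gamma>) * s"
    using one_diff_power_eq[of \<gamma> "Suc m"] by (simp add: s_def lessThan_Suc_atMost)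
  ultimately have main: "(1 - \<gamma>) * a 0 * s \<le> (L + c) * s - \<gamma> ^ m * \<eta>"
    by (simp add: ac_simps)
  have s_pos: "0 < s"
    unfolding s_def using \<gamma> by (intro sum_pos) auto
  \<comment> \<open>\<open>s\<close> is the discounted cycle length; bounding it by
    \<open>m + 1\<close> produces the denominator in the gain per step.\<close>
  have "s \<le> real m + 1"
    unfolding s_def using \<gamma> sum_bounded_above[of "{..m}" "\<lambda>j. \<gamma> ^ j" 1]
    by (auto simp: power_le_one)
  then have "\<gamma> ^ m * \<eta> / (real m + 1) \<le> \<gamma> ^ m * \<eta> / s"
    using \<gamma> gap s_pos by (intro divide_left_mono) auto
  moreover have "(1 - \<gamma>) * a 0 \<le> L + c - \<gamma> ^ m * \<eta> / s"
    using main s_pos by (simp add: field_simps)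
  ultimately show ?thesis by linarith
qed

text \<open>The infimum of the tail satisfies the same recursive inequality as its members; this replaces
  an optimization over stopping times.\<close>

lemma tail_value_ge:
  fixes w d :: "nat \<Rightarrow> real"
  assumes \<gamma>: "0 < \<gamma>" "\<gamma> < 1" and D: "0 \<le> D"
    and w: "\<And>k. 0 \<le> w k"
    and step: "\<And>k. K \<le> k \<Longrightarrow> min (g + \<gamma> * w (Suc k)) (g + D + \<gamma> * v) \<le> w k"
    and g: "(1 - \<gamma>) * D \<le> \<gamma> * (g - (1 - \<gamma>) * v)"
    and k: "K \<le> k"
  shows "D + \<gamma> * v \<le> \<gamma> * w k"
proof -
  define i where "i = (INF k\<in>{K..}. w k)"
  \<comment> \<open>Chosen so that \<gamma> u = D + \<gamma> v: restarting is no worse than waiting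
    exactly when the value one age later is at least \<open>u\<close>.\<close>
  define u where "u = v + D / \<gamma>"
  have bdd: "bdd_below (w ` {K..})"
    using w by (auto intro!: bdd_belowI[of _ 0])
  have i_le: "i \<le> w k" if "K \<le> k" for k
    unfolding i_def using that by (intro cINF_lower[OF bdd]) simp
  \<comment> \<open>Paying \<open>g\<close> per step forever costs g / (1 - \<gamma>); the
    assumption on \<open>g\<close> says that this is at least \<open>u\<close>.\<close>
  have gu: "(1 - \<gamma>) * u \<le> g"
  proof -
    have "(1 - \<gamma>) * D / \<gamma> \<le> g - (1 - \<gamma>) * v"
      using g \<gamma> by (simp add: field_simps)
    then show ?thesis
      by (simp add: u_def algebra_simps add_divide_distrib diff_divide_distrib)
  qed
  have \<gamma>u: "\<gamma> * u = D + \<gamma> * v"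
    using \<gamma> by (simp add: u_def field_simps)
  \<comment> \<open>The restart branch equals g + \<gamma> u, which is at least \<open>u\<close>;
    the waiting branch is bounded through the infimum.\<close>
  have "min (g + \<gamma> * i) u \<le> w k" if "K \<le> k" for k
  proof -
    have "\<gamma> * i \<le> \<gamma> * w (Suc k)"
      using \<gamma> i_le[of "Suc k"] that by (intro mult_left_mono) auto
    moreover have "u \<le> g + D + \<gamma> * v"
      using gu \<gamma>u by (simp add: algebra_simps)
    ultimately show ?thesis
      using step[OF that] by linarith
  qed
  then have "min (g + \<gamma> * i) u \<le> i"
    unfolding i_def by (intro cINF_greatest) auto
  \<comment> \<open>If the minimum is the waiting term, then i >= g + \<gamma> i, so i is at least g
    / (1 - \<gamma>) and hence at least \<open>u\<close>.\<close>
  then have "u \<le> i"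
  proof (cases "u \<le> g + \<gamma> * i")
    case False
    then have "g + \<gamma> * i \<le> i"
      using \<open>min (g + \<gamma> * i) u \<le> i\<close> by linarith
    then have "(1 - \<gamma>) * u \<le> (1 - \<gamma>) * i"
      using gu by (simp add: algebra_simps)
    then show ?thesis
      using \<gamma> by simp
  qed simp
  then have "\<gamma> * u \<le> \<gamma> * w k"
    using i_le[OF k] \<gamma> by (intro mult_left_mono) auto
  then show ?thesis
    using \<gamma>u by simp
qed

lemma ennreal_enn2real_of_le: "x \<le> ennreal b \<Longrightarrow> ennreal (enn2real x) = x"
  by (metis ennreal_enn2real ennreal_less_top le_less_trans)

lemma (in restart_problem) threshold_le:
  fixes L \<eta> e :: real
  assumes G: "\<And>a. 0 \<le> G a" and \<gamma>1: "\<gamma> < 1"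
    and L: "0 \<le> L"
    and upper: "\<And>k x. x \<in> space X \<Longrightarrow> state_cost k x \<le> ennreal L"
    and lower: "\<And>k x. x \<in> space X \<Longrightarrow> K \<le> k \<Longrightarrow> ennreal (L - e) \<le> state_cost k x"
    and e: "e \<le> \<gamma> ^ m * \<eta> / (2 * (real m + 1))"
    and D: "G NoInt \<le> G Restart" and \<eta>: "0 \<le> \<eta>"
    and gap: "G Restart - G NoInt + \<eta> \<le> (\<Sum>j\<le>m. L - enn2real (init_pow_fun X P \<nu> j F))"
    and small: "(1 - \<gamma>) * (G Restart - G NoInt) \<le> \<eta> * \<gamma> ^ (m + 1) / (2 * (real m + 1))"
    and x: "x \<in> space X"
  shows "threshold X P \<nu> F G \<gamma> x \<le> enat K"
proof -
  let ?V = "restart_value X P \<nu> F G \<gamma>"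
  \<comment> \<open>The discounted cost of paying L + G(n) at every step, that is, the solution of L
    + G(n) + \<gamma> B = B. It makes all values finite.\<close>
  define B where "B = (L + G NoInt) / (1 - \<gamma>)"
  interpret \<nu>: prob_space \<nu> by (rule \<nu>(1))
  have sp: "space \<nu> = space X"
    by (rule sets_eq_imp_space_eq[OF \<nu>(2)])
  have B0: "0 \<le> B"
    unfolding B_def using L G \<gamma>1 by auto
  have V_le: "?V y k \<le> ennreal B" if "y \<in> space X" for y k
  proof (rule restart_value_le[OF _ that])
    fix z k assume z: "z \<in> space X"
    have "state_cost k z + ennreal (G NoInt) + ennreal \<gamma> * ennreal B
        \<le> ennreal L + ennreal (G NoInt) + ennreal \<gamma> * ennreal B"
      by (intro add_right_mono upper z)
    also have "\<dots> = ennreal (L + G NoInt + \<gamma> * B)"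
      using L G \<gamma> B0 by (simp add: ennreal_plus ennreal_mult)
    also have "L + G NoInt + \<gamma> * B = B"
      using \<gamma>1 by (simp add: B_def field_simps)
    finally show "state_cost k z + ennreal (G NoInt) + ennreal \<gamma> * ennreal B \<le> ennreal B" .
  qed
  have V_fin: "ennreal (enn2real (?V y k)) = ?V y k" if "y \<in> space X" for y k
    by (rule ennreal_enn2real_of_le[OF V_le[OF that]])
  have c_fin: "ennreal (enn2real (state_cost k y)) = state_cost k y" if "y \<in> space X" for y k
    by (rule ennreal_enn2real_of_le[OF upper[OF that]])
  have [measurable]: "(\<lambda>y. ?V y k) \<in> borel_measurable \<nu>" "pow_fun X P k F \<in> borel_measurable \<nu>" for k
    using restart_value_measurable state_cost_measurable
    by (simp_all add: measurable_cong_sets[OF \<nu>(2) refl])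

  define a where "a k = enn2real (\<integral>\<^sup>+ z. ?V z k \<partial>\<nu>)" for k
  define p where "p k = enn2real (init_pow_fun X P \<nu> k F)" for k
  have "(\<integral>\<^sup>+ z. ?V z k \<partial>\<nu>) \<le> (\<integral>\<^sup>+ z. ennreal B \<partial>\<nu>)" for k
    by (intro nn_integral_mono V_le) (simp add: sp)
  then have a: "ennreal (a k) = (\<integral>\<^sup>+ z. ?V z k \<partial>\<nu>)" "0 \<le> a k" for k
    unfolding a_def using \<nu>.emeasure_space_1
    by (auto intro!: ennreal_enn2real_of_le[where b=B])
  have "init_pow_fun X P \<nu> k F \<le> (\<integral>\<^sup>+ z. ennreal L \<partial>\<nu>)" for k
    unfolding init_pow_fun_def by (intro nn_integral_mono upper) (simp add: sp)
  then have pL: "init_pow_fun X P \<nu> k F \<le> ennreal L" for k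
    using \<nu>.emeasure_space_1 by simp
  have p: "ennreal (p k) = init_pow_fun X P \<nu> k F" "0 \<le> p k" for k
    unfolding p_def by (simp_all add: ennreal_enn2real_of_le[OF pL])
  have p_le: "p k \<le> L" for k
    using pL[of k] L unfolding p(1)[symmetric] by simp
  have level: "restart_level X P \<nu> F G \<gamma> = ennreal (G Restart + \<gamma> * a 0)"
    unfolding restart_level_def a(1)[symmetric]
    using G \<gamma> a(2) by (simp add: ennreal_plus ennreal_mult)

  \<comment> \<open>Integrating the waiting branch of the Bellman equation over \<nu> turns the
    state cost into \<nu> P^j F; the restart branch at age \<open>m\<close> gives
    \<open>a_last\<close> in the same way.\<close>
  have a_step: "a j \<le> p j + G NoInt + \<gamma> * a (Suc j)" for j
  proof -
    have "ennreal (a j) \<le> (\<integral>\<^sup>+ z. state_cost j z + ennreal (G NoInt) + ennreal \<gamma> * ?V z (Suc j) \<partial>\<nu>)"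
      unfolding a(1) by (intro nn_integral_mono) (simp add: sp restart_value_bellman[of _ j])
    also have "\<dots> = init_pow_fun X P \<nu> j F + ennreal (G NoInt) + ennreal \<gamma> * ennreal (a (Suc j))"
      unfolding a(1) init_pow_fun_def
      by (simp add: nn_integral_add nn_integral_cmult \<nu>.emeasure_space_1)
    also have "\<dots> = ennreal (p j + G NoInt + \<gamma> * a (Suc j))"
      unfolding p(1)[symmetric] using G \<gamma> a(2) p(2) by (simp add: ennreal_plus ennreal_mult)
    finally show ?thesis
      using G \<gamma> a(2) p(2) by (subst (asm) ennreal_le_iff) auto
  qed
  have a_last: "a m \<le> p m + G NoInt + (G Restart - G NoInt) + \<gamma> * a 0"
  proof -
    have "ennreal (a m) \<le> (\<integral>\<^sup>+ z. state_cost m z + restart_level X P \<nu> F G \<gamma> \<partial>\<nu>)"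
      unfolding a(1) by (intro nn_integral_mono) (simp add: sp restart_value_bellman[of _ m])
    also have "\<dots> = init_pow_fun X P \<nu> m F + restart_level X P \<nu> F G \<gamma>"
      unfolding init_pow_fun_def by (simp add: nn_integral_add \<nu>.emeasure_space_1)
    also have "\<dots> = ennreal (p m + (G Restart + \<gamma> * a 0))"
      unfolding p(1)[symmetric] level using G \<gamma> a(2) p(2) by (subst ennreal_plus) auto
    finally show ?thesis
      using G \<gamma> a(2) p(2) by (subst (asm) ennreal_le_iff) auto
  qed
  have avg: "(1 - \<gamma>) * a 0 \<le> L + G NoInt - \<gamma> ^ m * \<eta> / (real m + 1)"
    using gap \<eta> by (intro cycle_average_le[OF \<gamma> \<gamma>1 a_step a_last p_le]) (simp_all add: p_def)

  define w where "w k = enn2real (?V x k)" for k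
  \<comment> \<open>From age \<open>K\<close> on, \<open>L - e\<close> is a lower bound for the
    running cost and may replace it in both branches of the minimum.\<close>
  have w_step: "min (L - e + G NoInt + \<gamma> * w (Suc k))
      (L - e + G NoInt + (G Restart - G NoInt) + \<gamma> * a 0) \<le> w k" if k: "K \<le> k" for k
  proof -
    define d where "d = enn2real (state_cost k x)"
    have d: "ennreal d = state_cost k x" "0 \<le> d"
      unfolding d_def by (simp_all add: c_fin x)
    have "L - e \<le> d"
      using lower[OF x k] d(2) unfolding d(1)[symmetric] by (simp add: ennreal_le_iff)
    have w0: "0 \<le> w k" for k by (simp add: w_def)
    have "ennreal (w k) = min (ennreal d + ennreal (G NoInt) + ennreal \<gamma> * ennreal (w (Suc k)))
        (ennreal d + ennreal (G Restart + \<gamma> * a 0))"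
      unfolding w_def V_fin[OF x] d(1) level[symmetric] by (rule restart_value_bellman[OF x])
    also have "\<dots> = ennreal (min (d + G NoInt + \<gamma> * w (Suc k)) (d + (G Restart + \<gamma> * a 0)))"
      using d(2) G \<gamma> a(2) w0 by (simp add: min_def ennreal_plus[symmetric] ennreal_mult[symmetric] del: ennreal_plus)
    finally have "w k = min (d + G NoInt + \<gamma> * w (Suc k)) (d + (G Restart + \<gamma> * a 0))"
      using d(2) G \<gamma> a(2) w0 by (subst (asm) ennreal_inj) auto
    with \<open>L - e \<le> d\<close> show ?thesis by linarith
  qed
  \<comment> \<open>The gain per step of the periodic strategy. Half of it absorbs \<open>e\<close>;
    \<gamma> times the other half covers the interest on the fee difference.\<close>
  define q where "q = \<gamma> ^ m * \<eta> / (real m + 1)"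
  have q: "\<gamma> ^ m * \<eta> / (2 * (real m + 1)) = q / 2"
    unfolding q_def divide_divide_eq_left by (simp only: mult.commute)
  have "(1 - \<gamma>) * (G Restart - G NoInt) \<le> \<gamma> * (\<gamma> ^ m * \<eta> / (2 * (real m + 1)))"
    using small by (simp add: ac_simps)
  also have "\<dots> \<le> \<gamma> * (L - e + G NoInt - (1 - \<gamma>) * a 0)"
    using avg e \<gamma> unfolding q q_def[symmetric] by (intro mult_left_mono) linarith+
  finally have "(1 - \<gamma>) * (G Restart - G NoInt) \<le> \<gamma> * (L - e + G NoInt - (1 - \<gamma>) * a 0)" .
  \<comment> \<open>The comparison in \<open>threshold\<close> at age \<open>K\<close> involves the
    value at age \<open>K + 1\<close>, hence the index \<open>Suc K\<close>.\<close>
  then have "G Restart - G NoInt + \<gamma> * a 0 \<le> \<gamma> * w (Suc K)"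
  proof (rule tail_value_ge[where w=w and K=K and g="L - e + G NoInt", OF \<gamma> \<gamma>1, rotated 3])
    show "0 \<le> G Restart - G NoInt"
      using D by simp
    show "0 \<le> w k" for k
      by (simp add: w_def)
    show "K \<le> Suc K"
      by simp
  qed (rule w_step)
  then have "restart_level X P \<nu> F G \<gamma> \<le> ennreal (G NoInt + \<gamma> * w (Suc K))"
    unfolding level by (intro ennreal_leI) simp
  also have "\<dots> = ennreal (G NoInt) + ennreal \<gamma> * ?V x (Suc K)"
    using G \<gamma> by (simp add: w_def ennreal_plus ennreal_mult V_fin[OF x])
  finally show ?thesis
    unfolding threshold_def by (intro Inf_lower) auto
qed

theorem theorem3:
  fixes X :: "'a measure" and P :: "'a \<Rightarrow> 'a measure" and \<nu> :: "'a measure"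
    and F :: "'a \<Rightarrow> ennreal" and G :: "action \<Rightarrow> real"
    and L C \<rho> \<eta> \<Delta>G :: real and m :: nat
  assumes X: "borel_space X"
    and P: "stochastic_kernel X X P"
    and \<nu>: "prob_space \<nu>" "sets \<nu> = sets X"
    and F: "F \<in> borel_measurable X"
    and G: "\<And>a. 0 \<le> G a"
    and mono: "\<And>x. x \<in> space X \<Longrightarrow> pow_fun X P 1 F x \<ge> F x"
    and \<rho>: "0 < \<rho>" "\<rho> < 1"
    and ergodic: "\<And>t. (SUP x\<in>space X. \<bar>enn2ereal (pow_fun X P t F x) - ereal L\<bar>) \<le> ereal (C * \<rho> ^ t)"
    and \<Delta>G: "\<Delta>G = G Restart - G NoInt"
    and gap: "\<Delta>G > 0" "\<eta> > 0"
      "(\<Sum>j=0..m. ereal L - enn2ereal (init_pow_fun X P \<nu> j F)) \<ge> ereal (\<Delta>G + \<eta>)"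
  shows "(\<exists>\<gamma>0\<in>{0<..<1}. \<exists>K::nat. \<forall>\<gamma>\<in>{\<gamma>0..<1}.
            (SUP x\<in>space X. threshold X P \<nu> F G \<gamma> x) < enat (K + 1))
    \<and> (\<exists>\<gamma>0\<in>{0<..<1::real}.
          (1 - \<gamma>0) * \<Delta>G \<le> \<eta> * \<gamma>0 ^ (m + 1) / (2 * (real m + 1)) \<and>
          (1 - \<gamma>0 ^ (m + 1)) * \<Delta>G < \<eta> * \<gamma>0 ^ (m + 1))
    \<and> (\<forall>\<gamma>0\<in>{0<..<1::real}.
          (1 - \<gamma>0) * \<Delta>G \<le> \<eta> * \<gamma>0 ^ (m + 1) / (2 * (real m + 1)) \<and>
          (1 - \<gamma>0 ^ (m + 1)) * \<Delta>G < \<eta> * \<gamma>0 ^ (m + 1) \<longrightarrow>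
          (let \<delta>0 = \<eta> * \<gamma>0 ^ m / (real m + 1);
               K = (LEAST t::nat. C * \<rho> ^ t \<le> \<delta>0 / 4)
           in \<forall>\<gamma>\<in>{\<gamma>0..<1}. (SUP x\<in>space X. threshold X P \<nu> F G \<gamma> x) < enat (K + 1)))"
proof -
  interpret \<nu>: prob_space \<nu> by (rule \<nu>(1))
  have sp: "space \<nu> = space X"
    by (rule sets_eq_imp_space_eq[OF \<nu>(2)])
  obtain x0 where x0: "x0 \<in> space X"
    using \<nu>.not_empty sp by auto

  define d where "d t x = enn2real (pow_fun X P t F x)" for t x
  \<comment> \<open>The real bound on the right forces P^t F to be finite on X, which justifies the
    passage to the real-valued \<open>d\<close>.\<close>
  have near: "\<bar>enn2ereal (pow_fun X P t F x) - ereal L\<bar> \<le> ereal (C * \<rho> ^ t)" if "x \<in> space X" for t x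
    using that by (intro order_trans[OF SUP_upper ergodic]) auto
  have d: "pow_fun X P t F x = ennreal (d t x)" "\<bar>d t x - L\<bar> \<le> C * \<rho> ^ t" "0 \<le> d t x"
    if "x \<in> space X" for t x
    using near[OF that, of t] unfolding d_def
    by (cases "pow_fun X P t F x"; simp add: enn2ereal_ennreal)+
  have d_mono: "incseq (\<lambda>t. d t x)" if x: "x \<in> space X" for x
    using incseq_pow_fun[OF P F x mono] d[OF x] by (simp add: incseq_def)
  have d_lim: "(\<lambda>t. d t x) \<longlonglongrightarrow> L" if x: "x \<in> space X" for x
  proof -
    have "(\<lambda>t. C * \<rho> ^ t) \<longlonglongrightarrow> C * 0"
      using \<rho> by (intro tendsto_mult_left LIMSEQ_realpow_zero) auto
    then have "(\<lambda>t. d t x - L) \<longlonglongrightarrow> 0"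
      using d(2)[OF x] by (auto intro: Lim_null_comparison[of _ "\<lambda>t. C * \<rho> ^ t"])
    then show ?thesis by (simp add: LIM_zero_iff)
  qed
  \<comment> \<open>An increasing sequence stays below its limit; this is how PF >= F yields the
    upper bound by L.\<close>
  have d_le: "d t x \<le> L" if "x \<in> space X" for t x
    using incseq_le[OF d_mono[OF that] d_lim[OF that]] .
  have L: "0 \<le> L"
    using d(3)[OF x0, of 0] d_le[OF x0, of 0] by linarith
  have C: "0 \<le> C"
    using d(2)[OF x0, of 0] by simp

  have upper: "pow_fun X P k F x \<le> ennreal L" if "x \<in> space X" for k x
    using d(1)[OF that] d_le[OF that] by (simp add: ennreal_leI)
  have init: "init_pow_fun X P \<nu> j F = ennreal (enn2real (init_pow_fun X P \<nu> j F))" for j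
  proof -
    have "init_pow_fun X P \<nu> j F \<le> (\<integral>\<^sup>+ z. ennreal L \<partial>\<nu>)"
      unfolding init_pow_fun_def by (intro nn_integral_mono upper) (simp add: sp)
    then show ?thesis
      using \<nu>.emeasure_space_1 by (intro ennreal_enn2real_of_le[symmetric, where b=L]) simp
  qed
  have "ereal L - enn2ereal (init_pow_fun X P \<nu> j F) = ereal (L - enn2real (init_pow_fun X P \<nu> j F))" for j
    by (subst init) (simp add: enn2ereal_ennreal)
  then have gap': "\<Delta>G + \<eta> \<le> (\<Sum>j\<le>m. L - enn2real (init_pow_fun X P \<nu> j F))"
    using gap(3) by (simp add: sum_ereal atMost_atLeast0)

  \<comment> \<open>The least index is fixed by \<gamma>0 and has to serve every \<gamma> in
    [\<gamma>0, 1) at once.\<close>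
  have main: "(SUP x\<in>space X. threshold X P \<nu> F G \<gamma> x) < enat ((LEAST t. C * \<rho> ^ t \<le> \<eta> * \<gamma>0 ^ m / (real m + 1) / 4) + 1)"
    if \<gamma>0: "0 < \<gamma>0" and small: "(1 - \<gamma>0) * \<Delta>G \<le> \<eta> * \<gamma>0 ^ (m + 1) / (2 * (real m + 1))"
      and \<gamma>1: "\<gamma>0 \<le> \<gamma>" "\<gamma> < 1" for \<gamma>0 \<gamma>
  proof -
    interpret restart_problem X P \<nu> F G \<gamma>
      using P \<nu> F \<gamma>0 \<gamma>1 by unfold_locales auto
    let ?e = "\<eta> * \<gamma>0 ^ m / (real m + 1) / 4"
    define K where "K = (LEAST t. C * \<rho> ^ t \<le> ?e)"
    have "0 < ?e"
      using gap \<gamma>0 by simp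
    moreover have "(\<lambda>t. C * \<rho> ^ t) \<longlonglongrightarrow> C * 0"
      using \<rho> by (intro tendsto_mult_left LIMSEQ_realpow_zero) auto
    ultimately have "\<forall>\<^sub>F t in sequentially. C * \<rho> ^ t < ?e"
      by (intro order_tendstoD(2)) auto
    then have "\<exists>t. C * \<rho> ^ t \<le> ?e"
      by (auto simp: eventually_sequentially intro: less_imp_le)
    then have K: "C * \<rho> ^ K \<le> ?e"
      unfolding K_def by (rule LeastI_ex)
    have lower: "ennreal (L - ?e) \<le> pow_fun X P k F x" if x: "x \<in> space X" and k: "K \<le> k" for k x
    proof -
      have "C * \<rho> ^ k \<le> C * \<rho> ^ K"
        using C \<rho> k by (intro mult_left_mono power_decreasing) auto
      then show ?thesis
        unfolding d(1)[OF x] using K d(2)[OF x, of k] by (intro ennreal_leI) linarith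
    qed
    have pow: "\<gamma>0 ^ n \<le> \<gamma> ^ n" for n
      using \<gamma>1 \<gamma>0 by (intro power_mono) auto
    \<comment> \<open>A quarter of the gain per step at \<gamma>0 is at most half of the gain at
      \<gamma>, since \<gamma>0^m <= \<gamma>^m.\<close>
    have e: "?e \<le> \<gamma> ^ m * \<eta> / (2 * (real m + 1))"
    proof -
      have "\<eta> * \<gamma>0 ^ m \<le> \<eta> * \<gamma> ^ m"
        using gap pow by (intro mult_left_mono) auto
      moreover have "0 \<le> \<eta> * \<gamma>0 ^ m"
        using gap \<gamma>0 by simp
      ultimately have "\<eta> * \<gamma>0 ^ m / (real m + 1) / 4 \<le> 2 * (\<eta> * \<gamma> ^ m) / (real m + 1) / 4"
        by (intro divide_right_mono) auto
      then show ?thesis by (simp add: field_simps)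
    qed
    \<comment> \<open>Raising \<gamma> lowers the interest and raises the gain, so the condition
      passes from \<gamma>0 to \<gamma>.\<close>
    have "(1 - \<gamma>) * \<Delta>G \<le> (1 - \<gamma>0) * \<Delta>G"
      using gap \<gamma>1 by (intro mult_right_mono) auto
    also have "\<dots> \<le> \<eta> * \<gamma>0 ^ (m + 1) / (2 * (real m + 1))"
      by (rule small)
    also have "\<dots> \<le> \<eta> * \<gamma> ^ (m + 1) / (2 * (real m + 1))"
      using gap pow[of "m + 1"] by (intro divide_right_mono mult_left_mono) auto
    finally have small': "(1 - \<gamma>) * (G Restart - G NoInt) \<le> \<eta> * \<gamma> ^ (m + 1) / (2 * (real m + 1))"
      unfolding \<Delta>G .
    have "threshold X P \<nu> F G \<gamma> x \<le> enat K" if "x \<in> space X" for x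
      using gap gap' unfolding \<Delta>G
      by (intro threshold_le[OF G \<gamma>1(2) L upper lower e _ _ _ small' that]) auto
    then have "(SUP x\<in>space X. threshold X P \<nu> F G \<gamma> x) \<le> enat K"
      by (rule SUP_least)
    also have "\<dots> < enat (K + 1)" by simp
    finally show ?thesis
      unfolding K_def .
  qed

  have ex: "\<exists>\<gamma>0\<in>{0<..<1::real}.
      (1 - \<gamma>0) * \<Delta>G \<le> \<eta> * \<gamma>0 ^ (m + 1) / (2 * (real m + 1)) \<and>
      (1 - \<gamma>0 ^ (m + 1)) * \<Delta>G < \<eta> * \<gamma>0 ^ (m + 1)"
  proof -
    \<comment> \<open>The differences of right and left sides tend to \<eta> / (2 (m + 1)) and
      \<eta> at 1. Both limits are positive, so both inequalities hold just below 1.\<close>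
    have "((\<lambda>g::real. \<eta> * g ^ (m + 1) / (2 * (real m + 1)) - (1 - g) * \<Delta>G) \<longlongrightarrow>
        \<eta> * 1 ^ (m + 1) / (2 * (real m + 1)) - (1 - 1) * \<Delta>G) (at_left 1)"
      by (intro tendsto_intros) auto
    then have "\<forall>\<^sub>F g in at_left (1::real). 0 < \<eta> * g ^ (m + 1) / (2 * (real m + 1)) - (1 - g) * \<Delta>G"
      by (rule order_tendstoD(1)) (use gap in simp)
    moreover have "((\<lambda>g::real. \<eta> * g ^ (m + 1) - (1 - g ^ (m + 1)) * \<Delta>G) \<longlongrightarrow>
        \<eta> * 1 ^ (m + 1) - (1 - 1 ^ (m + 1)) * \<Delta>G) (at_left 1)"
      by (intro tendsto_intros)
    then have "\<forall>\<^sub>F g in at_left (1::real). 0 < \<eta> * g ^ (m + 1) - (1 - g ^ (m + 1)) * \<Delta>G"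
      by (rule order_tendstoD(1)) (use gap in simp)
    moreover have "\<forall>\<^sub>F g in at_left (1::real). g \<in> {0<..<1}"
      by (rule eventually_at_leftI[of 0]) auto
    ultimately have "\<forall>\<^sub>F g in at_left (1::real). g \<in> {0<..<1} \<and>
        (1 - g) * \<Delta>G \<le> \<eta> * g ^ (m + 1) / (2 * (real m + 1)) \<and>
        (1 - g ^ (m + 1)) * \<Delta>G < \<eta> * g ^ (m + 1)"
      by eventually_elim linarith
    then show ?thesis
      by (blast dest: eventually_happens'[OF trivial_limit_at_left_real])
  qed
  show ?thesis
  proof (intro conjI ballI impI)
    show "\<exists>\<gamma>0\<in>{0<..<1}. \<exists>K::nat. \<forall>\<gamma>\<in>{\<gamma>0..<1}.
        (SUP x\<in>space X. threshold X P \<nu> F G \<gamma> x) < enat (K + 1)"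
    proof -
      from ex obtain \<gamma>0 where "\<gamma>0 \<in> {0<..<1}"
        "(1 - \<gamma>0) * \<Delta>G \<le> \<eta> * \<gamma>0 ^ (m + 1) / (2 * (real m + 1))" by blast
      then show ?thesis
        using main[of \<gamma>0] by (meson atLeastLessThan_iff greaterThanLessThan_iff)
    qed
  next
    show "\<exists>\<gamma>0\<in>{0<..<1::real}.
      (1 - \<gamma>0) * \<Delta>G \<le> \<eta> * \<gamma>0 ^ (m + 1) / (2 * (real m + 1)) \<and>
      (1 - \<gamma>0 ^ (m + 1)) * \<Delta>G < \<eta> * \<gamma>0 ^ (m + 1)"
      by (rule ex)
  next
    fix \<gamma>0 :: real
    assume "\<gamma>0 \<in> {0<..<1}" and "(1 - \<gamma>0) * \<Delta>G \<le> \<eta> * \<gamma>0 ^ (m + 1) / (2 * (real m + 1)) \<and>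
      (1 - \<gamma>0 ^ (m + 1)) * \<Delta>G < \<eta> * \<gamma>0 ^ (m + 1)"
    then have "0 < \<gamma>0" "(1 - \<gamma>0) * \<Delta>G \<le> \<eta> * \<gamma>0 ^ (m + 1) / (2 * (real m + 1))"
      by auto
    from main[OF this] show "let \<delta>0 = \<eta> * \<gamma>0 ^ m / (real m + 1);
        K = (LEAST t::nat. C * \<rho> ^ t \<le> \<delta>0 / 4)
      in \<forall>\<gamma>\<in>{\<gamma>0..<1}. (SUP x\<in>space X. threshold X P \<nu> F G \<gamma> x) < enat (K + 1)"
      unfolding Let_def by simp
  qed
qed

end
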